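(* Let $n\ge1$, let $A_i$, $B_i$ ($i\in[n]$) be finite nonempty sets, and let $M^{ab}_{ij}\ge 0$ and $r^{ab}_i\in\mathbb{R}$ be given for $i,j\in[n]$, $a\in A_i$, $b\in B_i$. Let $f:\mathbb{R}^n\to\mathbb{R}^n$ be given by $$f_i(v)=\min_{a\in A_i}\max_{b\in B_i}\Bigl(\sum_{j\in[n]}M^{ab}_{ij}v_j+r^{ab}_i\Bigr),\qquad i\in[n].$$ Assume that the spectral radii of all the matrices $M^{(\sigma\delta)}$, $\sigma\in A_{\mathrm M}$, $\delta\in B_{\mathrm M}$, are strictly less than $1$, so that $$\bar\omega:=\max_{\sigma\in A_{\mathrm M},\,\delta\in B_{\mathrm M}}r(M^{(\sigma\delta)})<1 .$$ Let $m_1$ be the cardinality of $\{(i,a)\mid i\in[n],\ a\in A_i\}$. Then the policy iteration algorithm for 2-player games applied to $f$ stops after at most $$(m_1-n)\Bigl(1+\Bigl\lfloor\frac{\log(1-\bar\omega)}{\log\bar\omega}\Bigr\rfloor\Bigr)$$ (external) iterations.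
   Context: $[n]=\{1,\dots,n\}$; $r(M)$ denotes the spectral radius of a matrix $M$. Let $A\supseteq A_i$ and $B\supseteq B_i$ for all $i$. Policies of the first (minimizing) player: $A_{\mathrm M}$ is the set of maps $\sigma:[n]\to A$ with $\sigma(i)\in A_i$ for all $i$. Policies of the second (maximizing) player: $B_{\mathrm M}$ is the set of maps $\delta:[n]\times A\to B$ with $\delta(i,a)\in B_i$ for all $i\in[n]$, $a\in A$. For $\sigma\in A_{\mathrm M}$, $\delta\in B_{\mathrm M}$ put $\sigma_i=\sigma(i)$, $\delta_i=\delta(i,\sigma(i))$, $M^{(\sigma\delta)}=(M^{\sigma_i\delta_i}_{ij})_{i,j}$, $r^{(\sigma\delta)}=(r^{\sigma_i\delta_i}_i)_i$, $f^{(\sigma\delta)}(v)=M^{(\sigma\delta)}v+r^{(\sigma\delta)}$, and $f^{(\sigma)}(v)=\max_{\delta\in B_{\mathrm M}}f^{(\sigma\delta)}(v)$ (coordinatewise), so that $f(v)=\min_{\sigma\in A_{\mathrm M}}f^{(\sigma)}(v)$. General policy iteration algorithm, for a set of policies $A_{\mathrm M}$ and maps $f=\min_\sigma f^{(\sigma)}$: (1) set $s=0$, choose $\sigma^0\in A_{\mathrm M}$ arbitrarily; (2) compute the fixed point $v^s$ of $f^{(\sigma^s)}$; (3) choose $\sigma^{s+1}$ with $f(v^s)=f^{(\sigma^{s+1})}(v^s)$, taking $\sigma^{s+1}=\sigma^s$ whenever possible; (4) if $\sigma^{s+1}=\sigma^s$ stop and return $v^s,\sigma^s$; otherwise increment $s$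 and go to (2). The same algorithm is used with $\max$ in place of $\min$. Policy iteration algorithm for 2-player games: run the general algorithm on $A_{\mathrm M},f,(f^{(\sigma)})$ (external iterations); in step (2) compute $v^s$ by running the general algorithm, in its $\max$ version, on $B_{\mathrm M}$, $f^{(\sigma^s)}$, $(f^{(\sigma^s\delta)})_{\delta\in B_{\mathrm M}}$ (internal iterations), where the fixed points of the affine maps $f^{(\sigma^s\delta)}$ are computed exactly by solving linear systems. Convention: iterations are numbered by the index $s$, starting from $0$; "stops after at most $N$ iterations" means that the value of $s$ at which the algorithm stops is at most $N$. When $\bar\omega=0$ the quotient $\log(1-\bar\omega)/\log\bar\omega$ is read as $0$. *)

theory Defs
  imports
    Complex_Main
    "HOL-Library.FuncSet"
    "Jordan_Normal_Form.Spectral_Radius"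
begin

text \<open>Coordinates are numbered \<open>0, \<dots>, n - 1\<close>, as for the vectors and matrices of
  \<open>Jordan_Normal_Form\<close>. The coefficient \<open>M a b i j\<close> and the reward \<open>r a b i\<close> are meaningful only
  for \<open>a \<in> As i\<close> and \<open>b \<in> Bs i\<close>, where \<open>As i \<subseteq> A\<close> and \<open>Bs i \<subseteq> B\<close>. Policies are extensional
  functions, so that equality of policies is equality of maps on their domains.\<close>

definition min_policies :: "nat \<Rightarrow> 'a set \<Rightarrow> (nat \<Rightarrow> 'a set) \<Rightarrow> (nat \<Rightarrow> 'a) set" where
  "min_policies n A As = {\<sigma> \<in> {..<n} \<rightarrow>\<^sub>E A. \<forall>i<n. \<sigma> i \<in> As i}"

definition max_policies ::
    "nat \<Rightarrow> 'a set \<Rightarrow> 'b set \<Rightarrow> (nat \<Rightarrow> 'b set) \<Rightarrow> (nat \<times> 'a \<Rightarrow> 'b) set" where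
  "max_policies n A B Bs = {\<delta> \<in> {..<n} \<times> A \<rightarrow>\<^sub>E B. \<forall>i<n. \<forall>a\<in>A. \<delta> (i, a) \<in> Bs i}"

definition policy_mat ::
    "nat \<Rightarrow> ('a \<Rightarrow> 'b \<Rightarrow> nat \<Rightarrow> nat \<Rightarrow> real) \<Rightarrow> (nat \<Rightarrow> 'a) \<Rightarrow> (nat \<times> 'a \<Rightarrow> 'b) \<Rightarrow> real mat" where
  "policy_mat n M \<sigma> \<delta> = mat n n (\<lambda>(i, j). M (\<sigma> i) (\<delta> (i, \<sigma> i)) i j)"

definition policy_vec ::
    "nat \<Rightarrow> ('a \<Rightarrow> 'b \<Rightarrow> nat \<Rightarrow> real) \<Rightarrow> (nat \<Rightarrow> 'a) \<Rightarrow> (nat \<times> 'a \<Rightarrow> 'b) \<Rightarrow> real vec" where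
  "policy_vec n r \<sigma> \<delta> = vec n (\<lambda>i. r (\<sigma> i) (\<delta> (i, \<sigma> i)) i)"

definition policy_radius ::
    "nat \<Rightarrow> ('a \<Rightarrow> 'b \<Rightarrow> nat \<Rightarrow> nat \<Rightarrow> real) \<Rightarrow> (nat \<Rightarrow> 'a) \<Rightarrow> (nat \<times> 'a \<Rightarrow> 'b) \<Rightarrow> real" where
  "policy_radius n M \<sigma> \<delta> = spectral_radius (map_mat complex_of_real (policy_mat n M \<sigma> \<delta>))"

text \<open>The three maps \<open>f\<close>, \<open>f\<^sup>(\<^sup>\<sigma>\<^sup>)\<close> and \<open>f\<^sup>(\<^sup>\<sigma>\<^sup>\<delta>\<^sup>)\<close>.
  The set \<open>max_policies n A B Bs\<close> is infinite if \<open>A\<close> is, but if the sets \<open>Bs i\<close> are finite then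
  the maximum in \<open>max_map\<close> is always over a finite set of reals, since only the values
  \<open>\<delta> (i, \<sigma> i) \<in> Bs i\<close> matter.\<close>

definition minmax_map ::
    "nat \<Rightarrow> (nat \<Rightarrow> 'a set) \<Rightarrow> (nat \<Rightarrow> 'b set) \<Rightarrow> ('a \<Rightarrow> 'b \<Rightarrow> nat \<Rightarrow> nat \<Rightarrow> real) \<Rightarrow>
      ('a \<Rightarrow> 'b \<Rightarrow> nat \<Rightarrow> real) \<Rightarrow> real vec \<Rightarrow> real vec" where
  "minmax_map n As Bs M r v =
     vec n (\<lambda>i. MIN a\<in>As i. MAX b\<in>Bs i. (\<Sum>j<n. M a b i j * v $ j) + r a b i)"

definition affine_map ::
    "nat \<Rightarrow> ('a \<Rightarrow> 'b \<Rightarrow> nat \<Rightarrow> nat \<Rightarrow> real) \<Rightarrow> ('a \<Rightarrow> 'b \<Rightarrow> nat \<Rightarrow> real) \<Rightarrow>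
      (nat \<Rightarrow> 'a) \<Rightarrow> (nat \<times> 'a \<Rightarrow> 'b) \<Rightarrow> real vec \<Rightarrow> real vec" where
  "affine_map n M r \<sigma> \<delta> v = policy_mat n M \<sigma> \<delta> *\<^sub>v v + policy_vec n r \<sigma> \<delta>"

definition max_map ::
    "nat \<Rightarrow> 'a set \<Rightarrow> 'b set \<Rightarrow> (nat \<Rightarrow> 'b set) \<Rightarrow> ('a \<Rightarrow> 'b \<Rightarrow> nat \<Rightarrow> nat \<Rightarrow> real) \<Rightarrow>
      ('a \<Rightarrow> 'b \<Rightarrow> nat \<Rightarrow> real) \<Rightarrow> (nat \<Rightarrow> 'a) \<Rightarrow> real vec \<Rightarrow> real vec" where
  "max_map n A B Bs M r \<sigma> v =
     vec n (\<lambda>i. MAX \<delta>\<in>max_policies n A B Bs. affine_map n M r \<sigma> \<delta> v $ i)"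

text \<open>Policy iteration is a nondeterministic transition system. \<open>Evaluate s p\<close>: iteration \<open>s\<close>,
  policy \<open>p\<close> is to be evaluated. \<open>Improve s p v\<close>: \<open>v\<close> has been computed for \<open>p\<close> and the next
  policy is to be chosen. \<open>Stopped s p v\<close>: the algorithm has stopped at iteration \<open>s\<close> and returned
  \<open>v\<close> and \<open>p\<close>.\<close>

datatype ('p, 'v) pi_state = Evaluate nat 'p | Improve nat 'p 'v | Stopped nat 'p 'v

text \<open>Choice of the next policy and stopping test, for a map \<open>f\<close> that is the minimum, or the
  maximum, of the maps \<open>fp p\<close> over the policies \<open>p \<in> P\<close>: the same rule serves both versions.
  The implication says that the current policy is kept whenever possible.\<close>

definition next_policy :: "'p set \<Rightarrow> ('v \<Rightarrow> 'v) \<Rightarrow> ('p \<Rightarrow> 'v \<Rightarrow> 'v) \<Rightarrow> 'p \<Rightarrow> 'v \<Rightarrow> 'p \<Rightarrow> bool" where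
  "next_policy P f fp p v p' \<longleftrightarrow> p' \<in> P \<and> f v = fp p' v \<and> (f v = fp p v \<longrightarrow> p' = p)"

inductive improve_step ::
    "'p set \<Rightarrow> ('v \<Rightarrow> 'v) \<Rightarrow> ('p \<Rightarrow> 'v \<Rightarrow> 'v) \<Rightarrow> ('p, 'v) pi_state \<Rightarrow> ('p, 'v) pi_state \<Rightarrow> bool"
  for P f fp where
  continue: "next_policy P f fp p v p' \<Longrightarrow> p' \<noteq> p \<Longrightarrow>
    improve_step P f fp (Improve s p v) (Evaluate (Suc s) p')"
| stop: "next_policy P f fp p v p' \<Longrightarrow> p' = p \<Longrightarrow>
    improve_step P f fp (Improve s p v) (Stopped s p v)"

text \<open>Internal iterations: the first player's policy \<open>\<sigma>\<close> is fixed, and the fixed points of the affine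
  maps are computed exactly.\<close>

inductive internal_step ::
    "nat \<Rightarrow> 'a set \<Rightarrow> 'b set \<Rightarrow> (nat \<Rightarrow> 'b set) \<Rightarrow> ('a \<Rightarrow> 'b \<Rightarrow> nat \<Rightarrow> nat \<Rightarrow> real) \<Rightarrow>
      ('a \<Rightarrow> 'b \<Rightarrow> nat \<Rightarrow> real) \<Rightarrow> (nat \<Rightarrow> 'a) \<Rightarrow>
      (nat \<times> 'a \<Rightarrow> 'b, real vec) pi_state \<Rightarrow> (nat \<times> 'a \<Rightarrow> 'b, real vec) pi_state \<Rightarrow> bool"
  for n A B Bs M r \<sigma> where
  solve: "v \<in> carrier_vec n \<Longrightarrow> affine_map n M r \<sigma> \<delta> v = v \<Longrightarrow>
    internal_step n A B Bs M r \<sigma> (Evaluate k \<delta>) (Improve k \<delta> v)"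
| improve: "improve_step (max_policies n A B Bs) (max_map n A B Bs M r \<sigma>) (affine_map n M r \<sigma>) x y
    \<Longrightarrow> internal_step n A B Bs M r \<sigma> x y"

text \<open>The whole two-player algorithm: \<open>Internal s \<sigma> x\<close> means that \<open>\<sigma>\<close>, the policy of external
  iteration \<open>s\<close>, is being evaluated and that the internal run is in state \<open>x\<close>.\<close>

datatype ('a, 'b) two_player_state =
    External "(nat \<Rightarrow> 'a, real vec) pi_state"
  | Internal nat "nat \<Rightarrow> 'a" "(nat \<times> 'a \<Rightarrow> 'b, real vec) pi_state"

inductive two_player_step ::
    "nat \<Rightarrow> 'a set \<Rightarrow> (nat \<Rightarrow> 'a set) \<Rightarrow> 'b set \<Rightarrow> (nat \<Rightarrow> 'b set) \<Rightarrow>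
      ('a \<Rightarrow> 'b \<Rightarrow> nat \<Rightarrow> nat \<Rightarrow> real) \<Rightarrow> ('a \<Rightarrow> 'b \<Rightarrow> nat \<Rightarrow> real) \<Rightarrow>
      ('a, 'b) two_player_state \<Rightarrow> ('a, 'b) two_player_state \<Rightarrow> bool"
  for n A As B Bs M r where
  call_internal: "\<delta> \<in> max_policies n A B Bs \<Longrightarrow>
    two_player_step n A As B Bs M r (External (Evaluate s \<sigma>)) (Internal s \<sigma> (Evaluate 0 \<delta>))"
| run_internal: "internal_step n A B Bs M r \<sigma> x y \<Longrightarrow>
    two_player_step n A As B Bs M r (Internal s \<sigma> x) (Internal s \<sigma> y)"
| return_internal:
    "two_player_step n A As B Bs M r (Internal s \<sigma> (Stopped k \<delta> v)) (External (Improve s \<sigma> v))"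
| improve_external:
    "improve_step (min_policies n A As) (minmax_map n As Bs M r) (max_map n A B Bs M r) x y \<Longrightarrow>
    two_player_step n A As B Bs M r (External x) (External y)"

text \<open>Every execution, for every initial policy and every choice made on the way, is finite (the
  internal iterations included), and where it cannot be continued the algorithm has stopped, at an
  external iteration \<open>s \<le> N\<close>. In particular, no execution gets stuck for want of a fixed
  point or of a next policy.\<close>

definition two_player_pi_stops_within ::
    "nat \<Rightarrow> 'a set \<Rightarrow> (nat \<Rightarrow> 'a set) \<Rightarrow> 'b set \<Rightarrow> (nat \<Rightarrow> 'b set) \<Rightarrow>
      ('a \<Rightarrow> 'b \<Rightarrow> nat \<Rightarrow> nat \<Rightarrow> real) \<Rightarrow> ('a \<Rightarrow> 'b \<Rightarrow> nat \<Rightarrow> real) \<Rightarrow> int \<Rightarrow> bool" where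
  "two_player_pi_stops_within n A As B Bs M r N \<longleftrightarrow>
     (\<forall>\<sigma>\<in>min_policies n A As.
        (\<nexists>c. c 0 = External (Evaluate 0 \<sigma>) \<and>
           (\<forall>k. two_player_step n A As B Bs M r (c k) (c (Suc k)))) \<and>
        (\<forall>x. (two_player_step n A As B Bs M r)\<^sup>*\<^sup>* (External (Evaluate 0 \<sigma>)) x \<and>
             (\<nexists>y. two_player_step n A As B Bs M r x y) \<longrightarrow>
           (\<exists>s \<sigma>' v. x = External (Stopped s \<sigma>' v) \<and> int s \<le> N)))"

end

theory Submission
  imports Defs
begin

text \<open>For every \<open>\<kappa> > \<omega>\<close> the spectral hypothesis yields one weight \<open>u > 0\<close> with
  \<open>M\<^sup>a\<^sup>b u \<le> \<kappa> u\<close> in every row and for all actions, so all the maps involved are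
  \<open>\<kappa>\<close>-contractions of the same weighted sup norm. The integer
  \<open>K = 1 + \<lfloor>ln (1 - \<omega>) / ln \<omega>\<rfloor>\<close> satisfies \<open>\<omega> ^ K < 1 - \<omega>\<close>, hence
  \<open>\<kappa> ^ K < 1 - \<kappa>\<close> for \<open>\<kappa>\<close> close to \<open>\<omega>\<close>. Under that condition every
  policy whose value is not the fixed point of \<open>f\<close> uses an action that no policy uses from
  \<open>K\<close> iterations later on. After \<open>m\<^sub>1 - n\<close> blocks of \<open>K\<close> iterations only \<open>n\<close> actions are
  left, that is, a single policy. Both levels of iteration terminate because the values
  computed are strictly monotone and there are finitely many of them.\<close>

section \<open>Spectral radius and Neumann series of a nonnegative matrix\<close>

lemma eigenvalue_smult_mat:
  fixes A :: "'a :: field mat"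
  assumes A: "A \<in> carrier_mat n n" and ev: "eigenvalue (c \<cdot>\<^sub>m A) k" and c: "c \<noteq> 0"
  shows "eigenvalue A (k / c)"
proof -
  from ev A obtain v where v: "v \<in> carrier_vec n" "v \<noteq> 0\<^sub>v n" "(c \<cdot>\<^sub>m A) *\<^sub>v v = k \<cdot>\<^sub>v v"
    by (auto simp: eigenvalue_def eigenvector_def)
  have "(c \<cdot>\<^sub>m A) *\<^sub>v v = c \<cdot>\<^sub>v (A *\<^sub>v v)"
    using v(1) A by (intro eq_vecI) (auto simp: scalar_prod_def sum_distrib_left mult.assoc)
  then have "c \<cdot>\<^sub>v (A *\<^sub>v v) = k \<cdot>\<^sub>v v" using v(3) by simp
  then have "(1 / c) \<cdot>\<^sub>v (c \<cdot>\<^sub>v (A *\<^sub>v v)) = (1 / c) \<cdot>\<^sub>v (k \<cdot>\<^sub>v v)"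
    by simp
  then have "A *\<^sub>v v = (k / c) \<cdot>\<^sub>v v"
    using c by (simp add: smult_smult_assoc)
  with v A show ?thesis
    by (auto simp: eigenvalue_def eigenvector_def)
qed

lemma spectral_radius_nonneg:
  assumes "A \<in> carrier_mat n n" "n > 0"
  shows "0 \<le> spectral_radius A"
  using spectral_radius_mem_max(1)[OF assms] by auto

text \<open>Scaling by \<open>1 / \<mu>\<close> divides every eigenvalue by \<open>\<mu>\<close>; a
  \<open>\<mu>\<close> strictly above the radius thus brings all of them into the open unit disc,
  where matrix powers stay bounded.\<close>

lemma spectral_radius_smult_less_1:
  assumes A: "A \<in> carrier_mat n n" and n: "n > 0" and mu: "spectral_radius A < \<mu>"
  shows "spectral_radius (complex_of_real (1 / \<mu>) \<cdot>\<^sub>m A) < 1"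
proof -
  have mu0: "\<mu> > 0" using spectral_radius_nonneg[OF A n] mu by simp
  let ?C = "complex_of_real (1 / \<mu>) \<cdot>\<^sub>m A"
  have C: "?C \<in> carrier_mat n n" using A by simp
  obtain k where k: "eigenvalue ?C k" "spectral_radius ?C = norm k"
    using spectral_radius_mem_max(1)[OF C n] by (auto simp: spectrum_def)
  have "eigenvalue A (k / complex_of_real (1 / \<mu>))"
    using eigenvalue_smult_mat[OF A k(1)] mu0 by simp
  then have "norm (k / complex_of_real (1 / \<mu>)) \<le> spectral_radius A"
    by (intro spectral_radius_mem_max(2)[OF A n]) (auto simp: spectrum_def)
  then have "norm k * \<mu> \<le> spectral_radius A" using mu0 by (simp add: norm_mult)
  then have "norm k * \<mu> < 1 * \<mu>" using mu by linarith
  then have "norm k < 1" using mu0 by (meson less_eq_real_def mult_right_less_imp_less)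
  with k show ?thesis by simp
qed

lemma pow_mat_Suc_left:
  assumes A: "(A :: 'a :: comm_ring_1 mat) \<in> carrier_mat n n"
  shows "A ^\<^sub>m Suc k = A * A ^\<^sub>m k"
proof (induction k)
  case 0
  show ?case using A by simp
next
  case (Suc k)
  have "A ^\<^sub>m Suc (Suc k) = (A * A ^\<^sub>m k) * A" using Suc by simp
  also have "\<dots> = A * (A ^\<^sub>m k * A)" using A by (intro assoc_mult_mat) auto
  finally show ?case by simp
qed

text \<open>\<open>x\<close> is the Neumann series of \<open>Q / \<kappa>\<close> applied to the
  all-ones vector. For \<open>\<mu>\<close> between the radius and \<open>\<kappa>\<close> the
  powers of \<open>Q / \<mu>\<close> are bounded, so the terms decay like
  \<open>(\<mu> / \<kappa>) ^ k\<close>.\<close>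

lemma nonneg_resolvent_exists:
  fixes Q :: "nat \<Rightarrow> nat \<Rightarrow> real"
  assumes n: "n > 0" and Q: "\<And>i j. i < n \<Longrightarrow> j < n \<Longrightarrow> Q i j \<ge> 0"
    and rad: "spectral_radius (map_mat complex_of_real (mat n n (\<lambda>(i, j). Q i j))) < \<kappa>"
  shows "\<exists>x. \<forall>i<n. 1 \<le> x i \<and> x i = 1 + (\<Sum>j<n. Q i j * x j) / \<kappa>"
proof -
  define A where "A = map_mat complex_of_real (mat n n (\<lambda>(i, j). Q i j))"
  have A: "A \<in> carrier_mat n n" by (simp add: A_def)
  obtain \<mu> where mu: "spectral_radius A < \<mu>" "\<mu> < \<kappa>"
    using rad dense A_def by blast
  have mu0: "\<mu> > 0" using spectral_radius_nonneg[OF A n] mu by simp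
  define C where "C = complex_of_real (1 / \<mu>) \<cdot>\<^sub>m A"
  have C: "C \<in> carrier_mat n n" using A by (simp add: C_def)
  obtain c where c: "\<And>k. norm_bound (C ^\<^sub>m k) c"
    using spectral_radius_jnf_norm_bound_less_1_upper_triangular[OF C]
      spectral_radius_smult_less_1[OF A n mu(1)] C_def by blast
  \<comment> \<open>The \<open>k\<close>-th term of the series, iterated on real functions so that
    its sign is evident.\<close>
  define y where "y k = ((\<lambda>z i. (\<Sum>j<n. Q i j * z j) / \<kappa>) ^^ k) (\<lambda>_. 1)" for k
  have y0: "y 0 i = 1" for i by (simp add: y_def)
  have ySuc: "y (Suc k) i = (\<Sum>j<n. Q i j * y k j) / \<kappa>" for k i by (simp add: y_def)
  have lam0: "\<kappa> > 0" using mu0 mu by simp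
  have ynn: "i < n \<Longrightarrow> y k i \<ge> 0" for k i
    by (induction k arbitrary: i) (use Q lam0 in \<open>auto simp: y0 ySuc intro!: sum_nonneg divide_nonneg_pos\<close>)
  have Ck: "C ^\<^sub>m k \<in> carrier_mat n n" for k using C by simp
  \<comment> \<open>This transfers the bound on the complex powers of \<open>C\<close> to the real
    iterates: up to the factor \<open>(\<mu> / \<kappa>) ^ k\<close>, \<open>y k\<close> consists of
    the row sums of \<open>C ^\<^sub>m k\<close>.\<close>
  have rowsum: "i < n \<Longrightarrow> complex_of_real (y k i) = complex_of_real ((\<mu> / \<kappa>) ^ k) * (\<Sum>j<n. (C ^\<^sub>m k) $$ (i, j))" for k i
  proof (induction k arbitrary: i)
    case 0
    then show ?case using C by (simp add: y0 one_mat_def sum.delta')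
  next
    case (Suc k)
    have entry: "(C ^\<^sub>m Suc k) $$ (i, j) = (\<Sum>l<n. complex_of_real (Q i l / \<mu>) * (C ^\<^sub>m k) $$ (l, j))"
      if "j < n" for j
      using that Suc.prems A C Ck[of k] unfolding pow_mat_Suc_left[OF C]
      by (auto simp: scalar_prod_def atLeast0LessThan C_def A_def intro!: sum.cong)
    have "(\<Sum>j<n. (C ^\<^sub>m Suc k) $$ (i, j))
        = (\<Sum>l<n. complex_of_real (Q i l / \<mu>) * (\<Sum>j<n. (C ^\<^sub>m k) $$ (l, j)))"
      using entry by (simp add: sum_distrib_left) (rule sum.swap)
    then have "complex_of_real ((\<mu> / \<kappa>) ^ Suc k) * (\<Sum>j<n. (C ^\<^sub>m Suc k) $$ (i, j))
        = (\<Sum>l<n. complex_of_real ((\<mu> / \<kappa>) ^ Suc k) * (complex_of_real (Q i l / \<mu>) * (\<Sum>j<n. (C ^\<^sub>m k) $$ (l, j))))"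
      by (simp only: sum_distrib_left)
    also have "\<dots> = (\<Sum>l<n. complex_of_real (Q i l / \<kappa>) * complex_of_real (y k l))"
      using mu0 by (intro sum.cong) (simp_all add: Suc.IH)
    also have "\<dots> = complex_of_real (y (Suc k) i)"
      by (simp add: ySuc sum_divide_distrib)
    finally show ?case by simp
  qed
  have ybound: "norm (y k i) \<le> (real n * c) * (\<mu> / \<kappa>) ^ k" if i: "i < n" for k i
  proof -
    have "norm (\<Sum>j<n. (C ^\<^sub>m k) $$ (i, j)) \<le> (\<Sum>j<n. c)"
      using c[of k] i carrier_matD[OF Ck[of k]] by (intro sum_norm_le) (simp add: norm_bound_def del: pow_mat_dim)
    then have "norm (complex_of_real (y k i)) \<le> (\<mu> / \<kappa>) ^ k * (real n * c)"
      unfolding rowsum[OF i] norm_mult norm_of_real using mu0 lam0 by (intro mult_mono) auto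
    then show ?thesis by (simp add: mult.commute)
  qed
  have summ: "summable (\<lambda>k. y k i)" if "i < n" for i
  proof (rule summable_comparison_test)
    show "\<exists>N. \<forall>k\<ge>N. norm (y k i) \<le> (real n * c) * (\<mu> / \<kappa>) ^ k"
      using ybound[OF that] by blast
    show "summable (\<lambda>k. (real n * c) * (\<mu> / \<kappa>) ^ k)"
      using mu mu0 by (intro summable_mult summable_geometric) simp
  qed
  define x where "x i = (\<Sum>k. y k i)" for i
  have eq: "x i = 1 + (\<Sum>j<n. Q i j * x j) / \<kappa>" if i: "i < n" for i
  proof -
    have "x i = (\<Sum>k. y (Suc k) i) + y 0 i"
      using suminf_split_head[OF summ[OF i]] by (simp add: x_def)
    also have "(\<Sum>k. y (Suc k) i) = (\<Sum>k. \<Sum>j<n. Q i j * y k j / \<kappa>)"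
      by (simp add: ySuc sum_divide_distrib)
    also have "\<dots> = (\<Sum>j<n. \<Sum>k. Q i j * y k j / \<kappa>)"
      by (rule suminf_sum) (auto intro!: summable_mult summable_divide summ)
    also have "\<dots> = (\<Sum>j<n. Q i j * x j / \<kappa>)"
      using summ by (intro sum.cong) (auto simp: x_def suminf_mult suminf_divide summable_mult)
    finally show ?thesis by (simp add: y0 sum_divide_distrib)
  qed
  have "x i \<ge> 0" if "i < n" for i
    using ynn[OF that] summ[OF that] by (simp add: x_def suminf_nonneg)
  then have "1 \<le> x i" if "i < n" for i
    using eq[OF that] Q that lam0 by (auto intro!: divide_nonneg_pos sum_nonneg)
  with eq show ?thesis by blast
qed

section \<open>A common weight for all row choices\<close>

text \<open>A row choice \<open>c\<close> maximizing the total mass of its resolvent \<open>x = 1 + Q\<^sub>c x / \<kappa>\<close> cannot be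
  improved in any single row, which makes \<open>x\<close> a common weight.\<close>

lemma common_weight_exists:
  fixes Q :: "nat \<Rightarrow> 'c \<Rightarrow> nat \<Rightarrow> real"
  assumes n: "n > 0" and lam0: "\<kappa> > 0"
    and R: "\<And>i. i < n \<Longrightarrow> finite (R i) \<and> R i \<noteq> {}"
    and Q: "\<And>i j c. i < n \<Longrightarrow> j < n \<Longrightarrow> c \<in> R i \<Longrightarrow> Q i c j \<ge> 0"
    and rad: "\<And>c. c \<in> Pi\<^sub>E {..<n} R \<Longrightarrow>
      spectral_radius (map_mat complex_of_real (mat n n (\<lambda>(i, j). Q i (c i) j))) < \<kappa>"
  shows "\<exists>u. (\<forall>i<n. u i > 0) \<and> (\<forall>i<n. \<forall>c\<in>R i. (\<Sum>j<n. Q i c j * u j) \<le> \<kappa> * u i)"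
proof -
  define C where "C = Pi\<^sub>E {..<n} R"
  have "\<exists>x. \<forall>c\<in>C. \<forall>i<n. 1 \<le> x c i \<and> x c i = 1 + (\<Sum>j<n. Q i (c i) j * x c j) / \<kappa>"
  proof (rule bchoice, rule ballI)
    fix c assume "c \<in> C"
    then show "\<exists>x. \<forall>i<n. 1 \<le> x i \<and> x i = 1 + (\<Sum>j<n. Q i (c i) j * x j) / \<kappa>"
      using rad Q by (intro nonneg_resolvent_exists[OF n]) (auto simp: C_def PiE_iff)
  qed
  then obtain x where x1: "\<And>c i. c \<in> C \<Longrightarrow> i < n \<Longrightarrow> 1 \<le> x c i"
    and xeq: "\<And>c i. c \<in> C \<Longrightarrow> i < n \<Longrightarrow> x c i = 1 + (\<Sum>j<n. Q i (c i) j * x c j) / \<kappa>"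
    by blast
  have finC: "finite C" using R by (auto simp: C_def intro!: finite_PiE)
  have neC: "C \<noteq> {}" using R by (auto simp: C_def PiE_eq_empty_iff)
  obtain c where c: "c \<in> C" and cmax: "\<And>c'. c' \<in> C \<Longrightarrow> (\<Sum>i<n. x c' i) \<le> (\<Sum>i<n. x c i)"
  proof -
    have "Max ((\<lambda>c. \<Sum>i<n. x c i) ` C) \<in> (\<lambda>c. \<Sum>i<n. x c i) ` C"
      using finC neC by simp
    then obtain c where "c \<in> C" "Max ((\<lambda>c. \<Sum>i<n. x c i) ` C) = (\<Sum>i<n. x c i)" by auto
    with finC show ?thesis
      by (intro that[of c]) (auto simp flip: \<open>Max _ = _\<close>)
  qed
  have "(\<Sum>j<n. Q i a j * x c j) \<le> \<kappa> * x c i" if i: "i < n" and a: "a \<in> R i" for i a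
  proof (rule ccontr)
    assume "\<not> ?thesis"
    then have viol: "x c i < (\<Sum>j<n. Q i a j * x c j) / \<kappa>"
      using lam0 by (simp add: field_simps)
    \<comment> \<open>Only row \<open>i\<close> is replaced, by the violating one. The new resolvent
      will dominate the old one, strictly at \<open>i\<close>, against the maximality of
      \<open>c\<close>.\<close>
    define c' where "c' = c(i := a)"
    have c': "c' \<in> C" using c a i by (auto simp: c'_def C_def PiE_iff extensional_def)
    have Qc': "Q k (c' k) j \<ge> 0" if "k < n" "j < n" for k j
      using c' that Q by (auto simp: C_def PiE_iff)
    define d where "d k = x c' k - x c k" for k
    \<comment> \<open>The old resolvent is a subsolution of the new equation: by equality in the
      unchanged rows and by the violation in row \<open>i\<close>.\<close>
    have dge: "(\<Sum>j<n. Q k (c' k) j * d j) / \<kappa> \<le> d k" if k: "k < n" for k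
    proof -
      have "x c k \<le> 1 + (\<Sum>j<n. Q k (c' k) j * x c j) / \<kappa>"
        using viol xeq[OF c k] by (cases "k = i") (auto simp: c'_def)
      then show ?thesis using xeq[OF c' k]
        by (simp add: d_def right_diff_distrib sum_subtractf diff_divide_distrib)
    qed
    \<comment> \<open>A minimum principle for \<open>d\<close>, measured against the weight
      \<open>x c'\<close>. In the minimizing row \<open>l\<close> the equation for
      \<open>x c'\<close> yields \<open>m * (x c' l - 1) \<le> m * x c' l\<close>, which excludes
      \<open>m < 0\<close>.\<close>
    define m where "m = Min ((\<lambda>k. d k / x c' k) ` {..<n})"
    have mle: "m * x c' k \<le> d k" if k: "k < n" for k
    proof -
      have "m \<le> d k / x c' k" unfolding m_def using k by (intro Min_le) auto
      then show ?thesis using x1[OF c' k] by (simp add: field_simps)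
    qed
    obtain l where l: "l < n" "m = d l / x c' l"
    proof -
      have "m \<in> (\<lambda>k. d k / x c' k) ` {..<n}" unfolding m_def using n by (intro Min_in) auto
      then show ?thesis using that by auto
    qed
    have m0: "m \<ge> 0"
    proof (rule ccontr)
      assume "\<not> m \<ge> 0"
      have "m * (x c' l - 1) = m * ((\<Sum>j<n. Q l (c' l) j * x c' j) / \<kappa>)"
        using xeq[OF c' l(1)] by simp
      also have "\<dots> = (\<Sum>j<n. Q l (c' l) j * (m * x c' j)) / \<kappa>"
        by (simp add: sum_distrib_left mult.left_commute)
      also have "\<dots> \<le> (\<Sum>j<n. Q l (c' l) j * d j) / \<kappa>"
        using lam0 Qc' l mle by (intro divide_right_mono sum_mono mult_left_mono) auto
      also have "\<dots> \<le> d l" by (rule dge[OF l(1)])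
      also have "\<dots> = m * x c' l" using l x1[OF c' l(1)] by simp
      finally show False using \<open>\<not> m \<ge> 0\<close> by (simp add: algebra_simps)
    qed
    have d0: "d k \<ge> 0" if "k < n" for k
      using mle[OF that] m0 x1[OF c' that] by (smt (verit) mult_nonneg_nonneg)
    have "x c i < 1 + (\<Sum>j<n. Q i (c' i) j * x c j) / \<kappa>" using viol by (simp add: c'_def)
    also have "\<dots> \<le> 1 + (\<Sum>j<n. Q i (c' i) j * x c' j) / \<kappa>"
      using d0 lam0 Qc' i by (intro add_left_mono divide_right_mono sum_mono mult_left_mono) (auto simp: d_def)
    also have "\<dots> = x c' i" using xeq[OF c' i] by simp
    finally have "(\<Sum>k<n. x c k) < (\<Sum>k<n. x c' k)"
      using i d0 by (intro sum_strict_mono_ex1) (auto simp: d_def)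
    with cmax[OF c'] show False by simp
  qed
  moreover have "x c i > 0" if "i < n" for i using x1[OF c that] by simp
  ultimately show ?thesis by blast
qed

section \<open>Monotone contractions in a weighted sup norm\<close>

lemma vec_le_iff:
  assumes "x \<in> carrier_vec n" "y \<in> carrier_vec n"
  shows "x \<le> y \<longleftrightarrow> (\<forall>i<n. x $ i \<le> y $ i)"
  using assms by (auto simp: less_eq_vec_def)

text \<open>Turns a strict comparison in the partial order of vectors into one of reals, on which
  the termination ranks are counted.\<close>

lemma sum_vec_mono_strict:
  fixes x y :: "real vec"
  assumes "x \<in> carrier_vec n" "y \<in> carrier_vec n" "x \<le> y" "x \<noteq> y"
  shows "(\<Sum>i<n. x $ i) < (\<Sum>i<n. y $ i)"
proof (rule sum_strict_mono_ex1)
  show "\<forall>i\<in>{..<n}. x $ i \<le> y $ i" using assms by (simp add: vec_le_iff)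
  then show "\<exists>i\<in>{..<n}. x $ i < y $ i"
    using assms by (metis carrier_vecD eq_vecI lessThan_iff order_less_le)
qed simp

locale weighted_contraction =
  fixes n :: nat and u :: "real vec" and \<kappa> :: real
  assumes u_carrier [simp]: "u \<in> carrier_vec n"
    and u_pos: "i < n \<Longrightarrow> 0 < u $ i"
    and kappa_pos: "0 < \<kappa>" and kappa_less_1: "\<kappa> < 1"
begin

text \<open>Monotone maps whose Lipschitz constant in the weighted sup norm is at most \<open>\<kappa>\<close>; taking
  \<open>c = 0\<close> gives monotonicity.\<close>

definition contracting :: "(real vec \<Rightarrow> real vec) \<Rightarrow> bool" where
  "contracting F \<longleftrightarrow> (\<forall>x\<in>carrier_vec n. F x \<in> carrier_vec n) \<and>
     (\<forall>x\<in>carrier_vec n. \<forall>y\<in>carrier_vec n. \<forall>c\<ge>0.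
        x \<le> y + c \<cdot>\<^sub>v u \<longrightarrow> F x \<le> F y + (\<kappa> * c) \<cdot>\<^sub>v u)"

text \<open>The single-coordinate form of \<open>contracting\<close>. Minima and maxima range over a
  different action set in each coordinate, so closure under them is proved at this level.\<close>

definition contracting_at :: "nat \<Rightarrow> (real vec \<Rightarrow> real) \<Rightarrow> bool" where
  "contracting_at i g \<longleftrightarrow> (\<forall>x\<in>carrier_vec n. \<forall>y\<in>carrier_vec n. \<forall>c\<ge>0.
        x \<le> y + c \<cdot>\<^sub>v u \<longrightarrow> g x \<le> g y + \<kappa> * c * u $ i)"

text \<open>Meaningful for contracting maps: existence comes from Banach iteration, uniqueness from
  \<open>sub_le_super\<close> applied in both directions.\<close>

definition fixpoint :: "(real vec \<Rightarrow> real vec) \<Rightarrow> real vec" where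
  "fixpoint F = (THE x. x \<in> carrier_vec n \<and> F x = x)"

lemma dim_u [simp]: "dim_vec u = n"
  using u_carrier by (rule carrier_vecD)

lemma contracting_carrier: "contracting F \<Longrightarrow> x \<in> carrier_vec n \<Longrightarrow> F x \<in> carrier_vec n"
  by (simp add: contracting_def)

lemma contractingD:
  "contracting F \<Longrightarrow> x \<in> carrier_vec n \<Longrightarrow> y \<in> carrier_vec n \<Longrightarrow> 0 \<le> c \<Longrightarrow>
    x \<le> y + c \<cdot>\<^sub>v u \<Longrightarrow> F x \<le> F y + (\<kappa> * c) \<cdot>\<^sub>v u"
  by (simp add: contracting_def)

lemma contracting_atD:
  "contracting_at i g \<Longrightarrow> x \<in> carrier_vec n \<Longrightarrow> y \<in> carrier_vec n \<Longrightarrow> 0 \<le> c \<Longrightarrow>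
    x \<le> y + c \<cdot>\<^sub>v u \<Longrightarrow> g x \<le> g y + \<kappa> * c * u $ i"
  by (simp add: contracting_at_def)

lemma add_0_smult_vec: "y \<in> carrier_vec n \<Longrightarrow> y + 0 \<cdot>\<^sub>v u = y"
  by (intro eq_vecI) auto

lemma contracting_mono:
  assumes "contracting F" "x \<in> carrier_vec n" "y \<in> carrier_vec n" "x \<le> y"
  shows "F x \<le> F y"
  using contractingD[OF assms(1-3), of 0] assms by (simp add: add_0_smult_vec contracting_carrier)

lemma contracting_vecI:
  assumes F: "\<And>x. x \<in> carrier_vec n \<Longrightarrow> F x \<in> carrier_vec n"
    and at: "\<And>i. i < n \<Longrightarrow> contracting_at i (\<lambda>v. F v $ i)"
  shows "contracting F"
  unfolding contracting_def
proof (intro conjI ballI allI impI)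
  fix x y c
  assume xy: "x \<in> carrier_vec n" "y \<in> carrier_vec n" "0 \<le> (c :: real)" "x \<le> y + c \<cdot>\<^sub>v u"
  have "F x $ i \<le> F y $ i + \<kappa> * c * u $ i" if "i < n" for i
    using contracting_atD[OF at[OF that] xy] .
  then show "F x \<le> F y + (\<kappa> * c) \<cdot>\<^sub>v u"
    using F xy by (subst vec_le_iff[of _ n]) auto
qed (use F in auto)

text \<open>Nonnegative coefficients carry \<open>x \<le> y + c u\<close> through the sum, and the
  weight inequality turns the added \<open>c u\<close> into at most
  \<open>\<kappa> * c * u $ i\<close>.\<close>

lemma contracting_at_affine:
  assumes i: "i < n" and m: "\<And>j. j < n \<Longrightarrow> m j \<ge> 0" and mu: "(\<Sum>j<n. m j * u $ j) \<le> \<kappa> * u $ i"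
  shows "contracting_at i (\<lambda>v. (\<Sum>j<n. m j * v $ j) + d)"
  unfolding contracting_at_def
proof (intro ballI allI impI)
  fix x y c
  assume xy: "x \<in> carrier_vec n" "y \<in> carrier_vec n" "0 \<le> (c :: real)" "x \<le> y + c \<cdot>\<^sub>v u"
  then have le: "x $ j \<le> y $ j + c * u $ j" if "j < n" for j
    using that by (auto simp: less_eq_vec_def)
  have "(\<Sum>j<n. m j * x $ j) \<le> (\<Sum>j<n. m j * (y $ j + c * u $ j))"
    using le m by (intro sum_mono mult_left_mono) auto
  also have "\<dots> = (\<Sum>j<n. m j * y $ j) + c * (\<Sum>j<n. m j * u $ j)"
    by (simp add: distrib_left sum.distrib sum_distrib_left mult.left_commute)
  also have "\<dots> \<le> (\<Sum>j<n. m j * y $ j) + c * (\<kappa> * u $ i)"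
    using mu xy by (intro add_left_mono mult_left_mono) auto
  finally show "(\<Sum>j<n. m j * x $ j) + d \<le> (\<Sum>j<n. m j * y $ j) + d + \<kappa> * c * u $ i"
    by (simp add: mult_ac)
qed

lemma contracting_at_Max:
  assumes S: "finite S" "S \<noteq> {}" and g: "\<And>b. b \<in> S \<Longrightarrow> contracting_at i (g b)"
  shows "contracting_at i (\<lambda>v. MAX b\<in>S. g b v)"
  unfolding contracting_at_def
proof (intro ballI allI impI)
  fix x y c
  assume xy: "x \<in> carrier_vec n" "y \<in> carrier_vec n" "0 \<le> (c :: real)" "x \<le> y + c \<cdot>\<^sub>v u"
  have "g b x \<le> (MAX b\<in>S. g b y) + \<kappa> * c * u $ i" if b: "b \<in> S" for b
  proof -
    have "g b y \<le> (MAX b\<in>S. g b y)" using S b by (intro Max_ge) auto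
    with contracting_atD[OF g[OF b] xy] show ?thesis by simp
  qed
  then show "(MAX b\<in>S. g b x) \<le> (MAX b\<in>S. g b y) + \<kappa> * c * u $ i"
    using S by (intro Max.boundedI) auto
qed

lemma contracting_at_Min:
  assumes S: "finite S" "S \<noteq> {}" and g: "\<And>b. b \<in> S \<Longrightarrow> contracting_at i (g b)"
  shows "contracting_at i (\<lambda>v. MIN b\<in>S. g b v)"
  unfolding contracting_at_def
proof (intro ballI allI impI)
  fix x y c
  assume xy: "x \<in> carrier_vec n" "y \<in> carrier_vec n" "0 \<le> (c :: real)" "x \<le> y + c \<cdot>\<^sub>v u"
  have "(MIN b\<in>S. g b x) - \<kappa> * c * u $ i \<le> g b y" if b: "b \<in> S" for b
  proof -
    have "(MIN b\<in>S. g b x) \<le> g b x" using S b by (intro Min_le) auto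
    with contracting_atD[OF g[OF b] xy] show ?thesis by simp
  qed
  then have "(MIN b\<in>S. g b x) - \<kappa> * c * u $ i \<le> (MIN b\<in>S. g b y)"
    using S by (intro Min.boundedI) auto
  then show "(MIN b\<in>S. g b x) \<le> (MIN b\<in>S. g b y) + \<kappa> * c * u $ i" by simp
qed

text \<open>Where \<open>(x - y) / u\<close> is largest, a positive value \<open>c\<close> would satisfy \<open>c \<le> \<kappa> c\<close>.\<close>

lemma sub_le_super:
  assumes F: "contracting F" and x: "x \<in> carrier_vec n" and y: "y \<in> carrier_vec n"
    and sub: "x \<le> F x" and super: "F y \<le> y"
  shows "x \<le> y"
proof (rule ccontr)
  assume "\<not> x \<le> y"
  then obtain k where k: "k < n" "y $ k < x $ k"
    using x y by (auto simp: vec_le_iff not_le)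
  define q where "q i = (x $ i - y $ i) / u $ i" for i
  define c where "c = Max (q ` {..<n})"
  have cge: "q i \<le> c" if "i < n" for i
    unfolding c_def using that by (intro Max_ge) auto
  have "c \<in> q ` {..<n}" unfolding c_def using k by (intro Max_in) auto
  then obtain i where i: "i < n" "c = q i" by auto
  have "q k > 0" using k u_pos by (simp add: q_def)
  then have c0: "c > 0" using cge[OF k(1)] by simp
  have "x \<le> y + c \<cdot>\<^sub>v u"
    using cge x y u_pos
    by (subst vec_le_iff[of _ n]) (auto simp: q_def field_simps)
  then have "F x \<le> F y + (\<kappa> * c) \<cdot>\<^sub>v u"
    using contractingD[OF F x y] c0 by simp
  then have "F x $ i \<le> F y $ i + \<kappa> * c * u $ i"
    using i(1) contracting_carrier[OF F y]
    by (auto simp: less_eq_vec_def)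
  moreover have "x $ i \<le> F x $ i"
    using sub i(1) contracting_carrier[OF F x] x by (simp add: vec_le_iff)
  moreover have "F y $ i \<le> y $ i"
    using super i(1) contracting_carrier[OF F y] y by (simp add: vec_le_iff)
  moreover have "x $ i - y $ i = c * u $ i" using i u_pos[of i] by (simp add: q_def)
  ultimately have "c * u $ i \<le> \<kappa> * (c * u $ i)" by (simp add: mult.assoc)
  moreover have "c * u $ i > 0" using c0 u_pos i by simp
  ultimately show False
    using kappa_less_1 mult_strict_right_mono[of \<kappa> 1 "c * u $ i"] by simp
qed

text \<open>Banach iteration from the zero vector, coordinate by coordinate: the increments of
  \<open>X\<close> are dominated by a geometric series times \<open>u\<close>.\<close>

lemma contracting_fixpoint_exists:
  assumes F: "contracting F"
  shows "\<exists>x\<in>carrier_vec n. F x = x"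
proof -
  note Fc = contracting_carrier[OF F]
  have Fle: "F x $ i \<le> F y $ i + \<kappa> * c * u $ i"
    if "x \<in> carrier_vec n" "y \<in> carrier_vec n" "0 \<le> c" "\<And>i. i < n \<Longrightarrow> x $ i \<le> y $ i + c * u $ i" "i < n"
    for x y c i
  proof -
    have "x \<le> y + c \<cdot>\<^sub>v u" using that by (subst vec_le_iff[of _ n]) auto
    then have "F x \<le> F y + (\<kappa> * c) \<cdot>\<^sub>v u" using contractingD[OF F] that by blast
    then show ?thesis using that Fc[of y] by (auto simp: less_eq_vec_def)
  qed
  have Fabs: "\<bar>F x $ i - F y $ i\<bar> \<le> \<kappa> * c * u $ i"
    if "x \<in> carrier_vec n" "y \<in> carrier_vec n" "0 \<le> c" "\<And>i. i < n \<Longrightarrow> \<bar>x $ i - y $ i\<bar> \<le> c * u $ i" "i < n"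
    for x y c i
  proof -
    have "F x $ i \<le> F y $ i + \<kappa> * c * u $ i"
      by (rule Fle) (use that in \<open>auto simp: abs_le_iff algebra_simps\<close>)
    moreover have "F y $ i \<le> F x $ i + \<kappa> * c * u $ i"
      by (rule Fle) (use that in \<open>auto simp: abs_le_iff algebra_simps\<close>)
    ultimately show ?thesis by simp
  qed
  define X where "X k = (F ^^ k) (0\<^sub>v n)" for k
  have X: "X k \<in> carrier_vec n" for k
    by (induction k) (auto simp: X_def Fc)
  have XSuc: "X (Suc k) = F (X k)" for k by (simp add: X_def)
  \<comment> \<open>An upper bound for the weighted norm of the first increment; the sum of the
    ratios serves in place of their maximum.\<close>
  define C where "C = (\<Sum>i<n. \<bar>X 1 $ i - X 0 $ i\<bar> / u $ i)"
  have C0: "C \<ge> 0" unfolding C_def using u_pos by (intro sum_nonneg divide_nonneg_pos) auto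
  have step: "i < n \<Longrightarrow> \<bar>X (Suc k) $ i - X k $ i\<bar> \<le> C * \<kappa> ^ k * u $ i" for i k
  proof (induction k arbitrary: i)
    case 0
    have "\<bar>X 1 $ i - X 0 $ i\<bar> / u $ i \<le> C"
      unfolding C_def using 0 u_pos by (intro member_le_sum) (auto intro!: divide_nonneg_pos)
    then show ?case using u_pos[OF 0] by (simp add: field_simps)
  next
    case (Suc k)
    have "\<bar>F (X (Suc k)) $ i - F (X k) $ i\<bar> \<le> \<kappa> * (C * \<kappa> ^ k) * u $ i"
      using Suc X C0 kappa_pos by (intro Fabs) auto
    then show ?case by (simp add: XSuc mult_ac)
  qed
  have conv: "\<exists>L. (\<lambda>k. X k $ i) \<longlonglongrightarrow> L" if i: "i < n" for i
  proof -
    have "summable (\<lambda>k. X (Suc k) $ i - X k $ i)"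
    proof (rule summable_comparison_test)
      show "\<exists>N. \<forall>k\<ge>N. norm (X (Suc k) $ i - X k $ i) \<le> C * \<kappa> ^ k * u $ i"
        using step[OF i] by auto
      show "summable (\<lambda>k. C * \<kappa> ^ k * u $ i)"
        using kappa_pos kappa_less_1 by (intro summable_mult summable_mult2 summable_geometric) simp
    qed
    then have "(\<lambda>m. \<Sum>k<m. X (Suc k) $ i - X k $ i) \<longlonglongrightarrow> (\<Sum>k. X (Suc k) $ i - X k $ i)"
      by (rule summable_LIMSEQ)
    then have "(\<lambda>m. (X m $ i - X 0 $ i) + X 0 $ i) \<longlonglongrightarrow> (\<Sum>k. X (Suc k) $ i - X k $ i) + X 0 $ i"
      unfolding sum_lessThan_telescope[of "\<lambda>k. X k $ i"] by (intro tendsto_add) auto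
    then show ?thesis by auto
  qed
  define l where "l i = lim (\<lambda>k. X k $ i)" for i
  have l: "(\<lambda>k. X k $ i) \<longlonglongrightarrow> l i" if "i < n" for i
    using conv[OF that] unfolding l_def by (simp add: convergent_def convergent_LIMSEQ_iff[symmetric])
  define L where "L = vec n l"
  have L: "L \<in> carrier_vec n" by (simp add: L_def)
  \<comment> \<open>Continuity of \<open>F\<close> at the limit: with \<open>c = e / u $ i\<close>,
    closeness within \<open>c * u\<close> in all coordinates gives an error below \<open>e\<close>
    at \<open>i\<close>.\<close>
  have FX: "(\<lambda>k. F (X k) $ i) \<longlonglongrightarrow> F L $ i" if i: "i < n" for i
  proof (rule LIMSEQ_I)
    fix e :: real assume e: "e > 0"
    define c where "c = e / u $ i"
    have c: "c > 0" using e u_pos i by (simp add: c_def)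
    have "\<forall>\<^sub>F k in sequentially. \<forall>j\<in>{..<n}. dist (X k $ j) (l j) < c * u $ j"
      using l c u_pos by (intro eventually_ball_finite ballI tendstoD) auto
    then obtain k0 where k0: "\<And>k j. k \<ge> k0 \<Longrightarrow> j < n \<Longrightarrow> \<bar>X k $ j - l j\<bar> < c * u $ j"
      unfolding eventually_sequentially by (auto simp: dist_real_def)
    have "norm (F (X k) $ i - F L $ i) < e" if "k \<ge> k0" for k
    proof -
      have "\<bar>F (X k) $ i - F L $ i\<bar> \<le> \<kappa> * c * u $ i"
        using k0[OF that] X L c i by (intro Fabs) (auto simp: L_def less_imp_le)
      also have "\<dots> < c * u $ i" using kappa_less_1 c u_pos[OF i] by simp
      finally show ?thesis using u_pos[OF i] by (simp add: c_def)
    qed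
    then show "\<exists>no. \<forall>k\<ge>no. norm (F (X k) $ i - F L $ i) < e" by blast
  qed
  have "F L $ i = L $ i" if i: "i < n" for i
    using LIMSEQ_unique[OF FX[OF i, folded XSuc] LIMSEQ_Suc[OF l[OF i]]] i by (simp add: L_def)
  then have "F L = L" using L Fc[OF L] by (intro eq_vecI) auto
  with L show ?thesis by blast
qed

lemma fixpoint_eqI:
  assumes F: "contracting F" and x: "x \<in> carrier_vec n" "F x = x"
  shows "fixpoint F = x"
  unfolding fixpoint_def
proof (rule the_equality)
  fix y assume "y \<in> carrier_vec n \<and> F y = y"
  with x show "y = x"
    using sub_le_super[OF F, of x y] sub_le_super[OF F, of y x] by auto
qed (use x in auto)

lemma fixpoint:
  assumes "contracting F"
  shows "fixpoint F \<in> carrier_vec n" "F (fixpoint F) = fixpoint F"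
  using contracting_fixpoint_exists[OF assms] fixpoint_eqI[OF assms] by auto

text \<open>A fixed point is a subsolution, so \<open>sub_le_super\<close> applies. This and
  \<open>fixpoint_ge\<close> compare the values of two policies by applying the map of one to the
  value of the other.\<close>

lemma fixpoint_le:
  assumes "contracting F" "y \<in> carrier_vec n" "F y \<le> y"
  shows "fixpoint F \<le> y"
  using sub_le_super[OF assms(1) _ assms(2)] fixpoint[OF assms(1)] assms(3) by simp

lemma fixpoint_ge:
  assumes "contracting F" "y \<in> carrier_vec n" "y \<le> F y"
  shows "y \<le> fixpoint F"
  using sub_le_super[OF assms(1) assms(2)] fixpoint[OF assms(1)] assms(3) by simp

end

section \<open>The maps of the game and the values of policies\<close>

text \<open>The spectral hypothesis is represented here by the weight \<open>u\<close> and the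
  inequality \<open>M_weight\<close>, which \<open>common_weight_exists\<close> supplies.\<close>

locale contracting_game = weighted_contraction n u \<kappa>
  for n :: nat and u :: "real vec" and \<kappa> :: real +
  fixes A :: "'a set" and As :: "nat \<Rightarrow> 'a set"
    and B :: "'b set" and Bs :: "nat \<Rightarrow> 'b set"
    and M :: "'a \<Rightarrow> 'b \<Rightarrow> nat \<Rightarrow> nat \<Rightarrow> real"
    and r :: "'a \<Rightarrow> 'b \<Rightarrow> nat \<Rightarrow> real"
  assumes As: "i < n \<Longrightarrow> finite (As i) \<and> As i \<noteq> {} \<and> As i \<subseteq> A"
    and Bs: "i < n \<Longrightarrow> finite (Bs i) \<and> Bs i \<noteq> {} \<and> Bs i \<subseteq> B"
    and M_nonneg: "i < n \<Longrightarrow> j < n \<Longrightarrow> a \<in> As i \<Longrightarrow> b \<in> Bs i \<Longrightarrow> M a b i j \<ge> 0"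
    and M_weight: "i < n \<Longrightarrow> a \<in> As i \<Longrightarrow> b \<in> Bs i \<Longrightarrow> (\<Sum>j<n. M a b i j * u $ j) \<le> \<kappa> * u $ i"
begin

abbreviation "P \<equiv> min_policies n A As"
abbreviation "D \<equiv> max_policies n A B Bs"
abbreviation "f \<equiv> minmax_map n As Bs M r"
abbreviation "fmax \<equiv> max_map n A B Bs M r"
abbreviation "faff \<equiv> affine_map n M r"

definition row_val :: "nat \<Rightarrow> 'a \<Rightarrow> 'b \<Rightarrow> real vec \<Rightarrow> real" where
  "row_val i a b v = (\<Sum>j<n. M a b i j * v $ j) + r a b i"

definition action_val :: "nat \<Rightarrow> 'a \<Rightarrow> real vec \<Rightarrow> real" where
  "action_val i a v = (MAX b\<in>Bs i. row_val i a b v)"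

text \<open>The value of a first-player policy against a second player who responds optimally: the
  result that each internal run has to return.\<close>

definition min_val :: "(nat \<Rightarrow> 'a) \<Rightarrow> real vec" where
  "min_val \<sigma> = fixpoint (fmax \<sigma>)"

definition max_val :: "(nat \<Rightarrow> 'a) \<Rightarrow> (nat \<times> 'a \<Rightarrow> 'b) \<Rightarrow> real vec" where
  "max_val \<sigma> \<delta> = fixpoint (faff \<sigma> \<delta>)"

lemma min_policyD: "\<sigma> \<in> P \<Longrightarrow> i < n \<Longrightarrow> \<sigma> i \<in> As i" "\<sigma> \<in> P \<Longrightarrow> i < n \<Longrightarrow> \<sigma> i \<in> A"
  using As by (auto simp: min_policies_def)

lemma max_policyD: "\<delta> \<in> D \<Longrightarrow> \<sigma> \<in> P \<Longrightarrow> i < n \<Longrightarrow> \<delta> (i, \<sigma> i) \<in> Bs i"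
  using min_policyD by (auto simp: max_policies_def)

lemma min_policy_exists:
  assumes "\<And>i. i < n \<Longrightarrow> a i \<in> As i"
  shows "\<exists>\<sigma>\<in>P. \<forall>i<n. \<sigma> i = a i"
  using assms subsetD[OF As[THEN conjunct2, THEN conjunct2]]
  by (intro bexI[of _ "restrict a {..<n}"]) (auto simp: min_policies_def)

text \<open>The witness ignores the action, which is admissible because \<open>Bs i\<close> depends
  on the coordinate alone.\<close>

lemma max_policy_exists:
  assumes "\<And>i. i < n \<Longrightarrow> b i \<in> Bs i"
  shows "\<exists>\<delta>\<in>D. \<forall>\<sigma>\<in>P. \<forall>i<n. \<delta> (i, \<sigma> i) = b i"
  using assms subsetD[OF Bs[THEN conjunct2, THEN conjunct2]] min_policyD(2)
  by (intro bexI[of _ "restrict (b \<circ> fst) ({..<n} \<times> A)"]) (auto simp: max_policies_def)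

lemma faff_carrier [simp]: "faff \<sigma> \<delta> v \<in> carrier_vec n"
  by (rule carrier_vecI) (simp add: affine_map_def policy_vec_def)

lemma fmax_carrier [simp]: "fmax \<sigma> v \<in> carrier_vec n"
  by (simp add: max_map_def)

lemma f_carrier [simp]: "f v \<in> carrier_vec n"
  by (simp add: minmax_map_def)

lemma map_dims [simp]: "dim_vec (faff \<sigma> \<delta> v) = n" "dim_vec (fmax \<sigma> v) = n" "dim_vec (f v) = n"
  by (rule carrier_vecD, simp)+

lemma faff_index:
  "v \<in> carrier_vec n \<Longrightarrow> i < n \<Longrightarrow> faff \<sigma> \<delta> v $ i = row_val i (\<sigma> i) (\<delta> (i, \<sigma> i)) v"
  by (auto simp: affine_map_def policy_mat_def policy_vec_def row_val_def scalar_prod_def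
      atLeast0LessThan)

text \<open>The maximum over whole policies decouples: coordinate \<open>i\<close> sees only
  \<open>\<delta> (i, \<sigma> i)\<close>, and every element of \<open>Bs i\<close> occurs there for
  some policy.\<close>

lemma fmax_index:
  assumes "\<sigma> \<in> P" "v \<in> carrier_vec n" "i < n"
  shows "fmax \<sigma> v $ i = action_val i (\<sigma> i) v"
proof -
  have "\<exists>\<delta>\<in>D. \<delta> (i, \<sigma> i) = b" if b: "b \<in> Bs i" for b
  proof -
    have "\<exists>\<delta>\<in>D. \<forall>\<sigma>\<in>P. \<forall>k<n. \<delta> (k, \<sigma> k) = (if k = i then b else SOME b. b \<in> Bs k)"
      using b Bs by (intro max_policy_exists) (auto simp: some_in_eq)
    then show ?thesis using assms by (metis (full_types))
  qed
  then have "(\<lambda>\<delta>. faff \<sigma> \<delta> v $ i) ` D = (\<lambda>b. row_val i (\<sigma> i) b v) ` Bs i"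
    using assms max_policyD by (fastforce simp: faff_index image_iff)
  then show ?thesis using assms by (simp add: max_map_def action_val_def)
qed

lemma f_index: "i < n \<Longrightarrow> f v $ i = (MIN a\<in>As i. action_val i a v)"
  by (simp add: minmax_map_def action_val_def row_val_def)

lemma contracting_at_row_val:
  "i < n \<Longrightarrow> a \<in> As i \<Longrightarrow> b \<in> Bs i \<Longrightarrow> contracting_at i (row_val i a b)"
  unfolding row_val_def using M_nonneg M_weight by (intro contracting_at_affine) auto

lemma contracting_at_action_val:
  "i < n \<Longrightarrow> a \<in> As i \<Longrightarrow> contracting_at i (action_val i a)"
  unfolding action_val_def using Bs contracting_at_row_val by (intro contracting_at_Max) auto

lemma contracting_at_cong:
  "contracting_at i g \<Longrightarrow> (\<And>v. v \<in> carrier_vec n \<Longrightarrow> g v = h v) \<Longrightarrow> contracting_at i h"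
  by (simp add: contracting_at_def)

lemma contracting_faff: "\<sigma> \<in> P \<Longrightarrow> \<delta> \<in> D \<Longrightarrow> contracting (faff \<sigma> \<delta>)"
  by (intro contracting_vecI contracting_at_cong[OF contracting_at_row_val])
    (auto simp: faff_index min_policyD max_policyD)

lemma contracting_fmax: "\<sigma> \<in> P \<Longrightarrow> contracting (fmax \<sigma>)"
  by (intro contracting_vecI contracting_at_cong[OF contracting_at_action_val])
    (auto simp: fmax_index min_policyD)

lemma contracting_f: "contracting f"
proof (rule contracting_vecI)
  fix i assume i: "i < n"
  show "contracting_at i (\<lambda>v. f v $ i)"
    unfolding f_index[OF i] using As[OF i] i contracting_at_action_val
    by (intro contracting_at_Min) auto
qed simp

lemma faff_le_fmax:
  assumes "\<sigma> \<in> P" "\<delta> \<in> D" "v \<in> carrier_vec n"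
  shows "faff \<sigma> \<delta> v \<le> fmax \<sigma> v"
  using assms Bs max_policyD
  by (subst vec_le_iff[of _ n]) (auto simp: faff_index fmax_index action_val_def intro!: Max_ge)

lemma f_le_fmax:
  assumes "\<sigma> \<in> P" "v \<in> carrier_vec n"
  shows "f v \<le> fmax \<sigma> v"
  using assms As min_policyD
  by (subst vec_le_iff[of _ n]) (auto simp: f_index fmax_index intro!: Min_le)

text \<open>Maximizers chosen separately in each coordinate combine into one policy, which attains
  all the maxima at once.\<close>

lemma greedy_max_policy_exists:
  assumes "\<sigma> \<in> P" "v \<in> carrier_vec n"
  shows "\<exists>\<delta>\<in>D. fmax \<sigma> v = faff \<sigma> \<delta> v"
proof -
  have "\<exists>b. b \<in> Bs i \<and> action_val i (\<sigma> i) v = row_val i (\<sigma> i) b v" if "i < n" for i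
  proof -
    have "action_val i (\<sigma> i) v \<in> (\<lambda>b. row_val i (\<sigma> i) b v) ` Bs i"
      unfolding action_val_def using Bs[OF that] by (intro Max_in) auto
    then show ?thesis by auto
  qed
  then obtain b where b: "\<And>i. i < n \<Longrightarrow> b i \<in> Bs i"
    "\<And>i. i < n \<Longrightarrow> action_val i (\<sigma> i) v = row_val i (\<sigma> i) (b i) v" by metis
  then obtain \<delta> where "\<delta> \<in> D" "\<And>i. i < n \<Longrightarrow> \<delta> (i, \<sigma> i) = b i"
    using max_policy_exists assms(1) by metis
  moreover from this have "fmax \<sigma> v = faff \<sigma> \<delta> v"
    using assms b
    by (intro eq_vecI) (auto simp: faff_index fmax_index)
  ultimately show ?thesis by blast
qed

lemma greedy_min_policy_exists:
  assumes "v \<in> carrier_vec n"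
  shows "\<exists>\<sigma>\<in>P. f v = fmax \<sigma> v"
proof -
  have "\<exists>a. a \<in> As i \<and> f v $ i = action_val i a v" if "i < n" for i
  proof -
    have "f v $ i \<in> (\<lambda>a. action_val i a v) ` As i"
      unfolding f_index[OF that] using As[OF that] by (intro Min_in) auto
    then show ?thesis by auto
  qed
  then obtain a where a: "\<And>i. i < n \<Longrightarrow> a i \<in> As i"
    "\<And>i. i < n \<Longrightarrow> f v $ i = action_val i (a i) v" by metis
  then obtain \<sigma> where \<sigma>: "\<sigma> \<in> P" "\<And>i. i < n \<Longrightarrow> \<sigma> i = a i"
    using min_policy_exists by metis
  moreover from this have "f v = fmax \<sigma> v"
    using assms a
    by (intro eq_vecI) (auto simp: fmax_index)
  ultimately show ?thesis by blast
qed

lemma min_val: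
  assumes "\<sigma> \<in> P"
  shows "min_val \<sigma> \<in> carrier_vec n" "fmax \<sigma> (min_val \<sigma>) = min_val \<sigma>"
  using fixpoint[OF contracting_fmax[OF assms]] by (simp_all add: min_val_def)

lemma max_val:
  assumes "\<sigma> \<in> P" "\<delta> \<in> D"
  shows "max_val \<sigma> \<delta> \<in> carrier_vec n" "faff \<sigma> \<delta> (max_val \<sigma> \<delta>) = max_val \<sigma> \<delta>"
  using fixpoint[OF contracting_faff[OF assms]] by (simp_all add: max_val_def)

text \<open>The old value \<open>w\<close> satisfies \<open>w = faff \<sigma> \<delta> w \<le> fmax
  \<sigma> w = faff \<sigma> \<delta>' w\<close>, so it is a subsolution for
  \<open>\<delta>'\<close>. If the values agreed, \<open>w\<close> would be fixed by
  \<open>fmax \<sigma>\<close> and the rule would have kept \<open>\<delta>\<close>.\<close>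

lemma max_val_improves:
  assumes \<sigma>: "\<sigma> \<in> P" and \<delta>: "\<delta> \<in> D"
    and next_p: "next_policy D (fmax \<sigma>) (faff \<sigma>) \<delta> (max_val \<sigma> \<delta>) \<delta>'" "\<delta>' \<noteq> \<delta>"
  shows "max_val \<sigma> \<delta> \<le> max_val \<sigma> \<delta>'" "max_val \<sigma> \<delta> \<noteq> max_val \<sigma> \<delta>'"
proof -
  let ?w = "max_val \<sigma> \<delta>"
  have \<delta>': "\<delta>' \<in> D" and eq: "fmax \<sigma> ?w = faff \<sigma> \<delta>' ?w" and neq: "fmax \<sigma> ?w \<noteq> ?w"
    using next_p max_val[OF \<sigma> \<delta>] by (auto simp: next_policy_def)
  show "?w \<le> max_val \<sigma> \<delta>'"
    using faff_le_fmax[OF \<sigma> \<delta>, of ?w] max_val[OF \<sigma> \<delta>] eq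
    unfolding max_val_def[of \<sigma> \<delta>'] by (intro fixpoint_ge contracting_faff \<sigma> \<delta>') auto
  show "?w \<noteq> max_val \<sigma> \<delta>'"
  proof
    assume "?w = max_val \<sigma> \<delta>'"
    then have "faff \<sigma> \<delta>' ?w = ?w" using max_val(2)[OF \<sigma> \<delta>'] by (rule ssubst)
    with eq neq show False by (auto dest: trans)
  qed
qed

section \<open>External improvement steps and elimination of actions\<close>

definition improves :: "(nat \<Rightarrow> 'a) \<Rightarrow> (nat \<Rightarrow> 'a) \<Rightarrow> bool" where
  "improves \<sigma> \<sigma>' \<longleftrightarrow> next_policy P f fmax \<sigma> (min_val \<sigma>) \<sigma>' \<and> \<sigma>' \<noteq> \<sigma>"

text \<open>Dual to the internal case: the old value is a supersolution for the new policy. The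
  bound by \<open>f (min_val \<sigma>)\<close> says that policy iteration advances at least as far
  as one step of value iteration; the rate of convergence comes from it.\<close>

lemma improves:
  assumes \<sigma>: "\<sigma> \<in> P" and imp: "improves \<sigma> \<sigma>'"
  shows "\<sigma>' \<in> P" "f (min_val \<sigma>) \<noteq> min_val \<sigma>" "min_val \<sigma>' \<le> f (min_val \<sigma>)"
    "min_val \<sigma>' \<le> min_val \<sigma>" "min_val \<sigma>' \<noteq> min_val \<sigma>"
proof -
  let ?w = "min_val \<sigma>"
  show \<sigma>': "\<sigma>' \<in> P" and neq: "f ?w \<noteq> ?w"
    using imp min_val[OF \<sigma>] by (auto simp: improves_def next_policy_def)
  have eq: "f ?w = fmax \<sigma>' ?w" using imp by (simp add: improves_def next_policy_def)
  have le: "f ?w \<le> ?w"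
    using f_le_fmax[OF \<sigma>, of ?w] min_val[OF \<sigma>] by simp
  have le': "min_val \<sigma>' \<le> ?w"
    using le eq min_val[OF \<sigma>] unfolding min_val_def[of \<sigma>']
    by (intro fixpoint_le contracting_fmax \<sigma>') auto
  then show "min_val \<sigma>' \<le> ?w" .
  have "fmax \<sigma>' (min_val \<sigma>') \<le> fmax \<sigma>' ?w"
    by (rule contracting_mono[OF contracting_fmax[OF \<sigma>'] min_val(1)[OF \<sigma>'] min_val(1)[OF \<sigma>] le'])
  then show "min_val \<sigma>' \<le> f ?w" using eq min_val[OF \<sigma>'] by simp
  show "min_val \<sigma>' \<noteq> ?w" 
  proof
    assume "min_val \<sigma>' = ?w"
    then have "fmax \<sigma>' ?w = ?w" using min_val(2)[OF \<sigma>'] by (rule subst)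
    with eq neq show False by (auto dest: trans)
  qed
qed

definition vopt :: "real vec" where "vopt = fixpoint f"

lemma vopt: "vopt \<in> carrier_vec n" "f vopt = vopt"
  using fixpoint[OF contracting_f] by (simp_all add: vopt_def)

lemma vopt_le_min_val:
  assumes "\<sigma> \<in> P"
  shows "vopt \<le> min_val \<sigma>"
  using f_le_fmax[OF assms min_val(1)[OF assms]] min_val[OF assms]
  unfolding vopt_def by (intro fixpoint_le contracting_f) auto

text \<open>The action eliminated is the one used where the weighted residual
  \<open>(f\<^sup>(\<^sup>\<sigma>\<^sup>)(v\<^sup>*) - v\<^sup>*) / u\<close> of the present policy at the solution \<open>v\<^sup>*\<close> is
  largest: the residual bounds the distance of the present value to \<open>v\<^sup>*\<close>, and \<open>K\<close> iterations
  later the distance, hence the residual of every action still in use, is smaller.\<close>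

lemma action_eliminated:
  assumes P: "\<And>t. t \<le> s \<Longrightarrow> p t \<in> P"
    and imp: "\<And>t. t < s \<Longrightarrow> improves (p t) (p (Suc t))"
    and K: "K > 0" "\<kappa> ^ K < 1 - \<kappa>" and t: "t + K \<le> s"
  shows "\<exists>i<n. \<forall>k\<ge>K. t + k \<le> s \<longrightarrow> p (t + k) i \<noteq> p t i"
proof -
  let ?\<sigma> = "p t"
  have \<sigma>: "?\<sigma> \<in> P" using P t by simp
  have ts: "t < s" using t K by simp
  define res where "res i = fmax ?\<sigma> vopt $ i - vopt $ i" for i
  \<comment> \<open>Iteration \<open>t\<close> is not the last one, and a policy whose value is
    \<open>vopt\<close> would have been kept.\<close>
  have neq: "min_val ?\<sigma> \<noteq> vopt"
    using improves(2)[OF \<sigma> imp[OF ts]] vopt(2) by auto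
  \<comment> \<open>Otherwise \<open>vopt\<close> would be a supersolution for the policy and hence
    bound its value from above.\<close>
  have "\<exists>k<n. res k > 0"
  proof (rule ccontr)
    assume "\<not> ?thesis"
    then have "fmax ?\<sigma> vopt \<le> vopt"
      using vopt by (subst vec_le_iff[of _ n]) (auto simp: res_def not_less dest: leD)
    then have "min_val ?\<sigma> \<le> vopt"
      unfolding min_val_def using vopt \<sigma> by (intro fixpoint_le contracting_fmax) auto
    with vopt_le_min_val[OF \<sigma>] neq show False by auto
  qed
  then obtain k where k: "k < n" "res k > 0" by blast
  define c where "c = Max ((\<lambda>i. res i / u $ i) ` {..<n})"
  have cge: "res i / u $ i \<le> c" if "i < n" for i
    unfolding c_def using that by (intro Max_ge) auto
  have "c \<in> (\<lambda>i. res i / u $ i) ` {..<n}" unfolding c_def using k by (intro Max_in) auto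
  then obtain i where i: "i < n" "c = res i / u $ i" by auto
  have c0: "c > 0" using cge[OF k(1)] k u_pos[OF k(1)] by (smt (verit) divide_pos_pos)
  \<comment> \<open>The solution of \<open>c + \<kappa> * d = d\<close>, which makes
    \<open>vopt + d u\<close> a supersolution for the policy.\<close>
  define d where "d = c / (1 - \<kappa>)"
  have d0: "d > 0" using c0 kappa_less_1 by (simp add: d_def)
  have d_eq: "c + \<kappa> * d = d" using kappa_less_1 by (simp add: d_def field_simps)
  have dist0: "min_val ?\<sigma> \<le> vopt + d \<cdot>\<^sub>v u"
    unfolding min_val_def
  proof (rule fixpoint_le)
    show y: "vopt + d \<cdot>\<^sub>v u \<in> carrier_vec n" using vopt by simp
    have "fmax ?\<sigma> (vopt + d \<cdot>\<^sub>v u) \<le> fmax ?\<sigma> vopt + (\<kappa> * d) \<cdot>\<^sub>v u"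
      using vopt y d0 kappa_pos by (intro contractingD[OF contracting_fmax[OF \<sigma>]]) auto
    also have "\<dots> \<le> vopt + d \<cdot>\<^sub>v u"
    proof (subst vec_le_iff[of _ n]; (intro allI impI)?)
      fix j assume j: "j < n"
      have "fmax ?\<sigma> vopt $ j \<le> vopt $ j + c * u $ j"
        using cge[OF j] u_pos[OF j] by (simp add: res_def field_simps)
      then have "fmax ?\<sigma> vopt $ j + \<kappa> * d * u $ j \<le> vopt $ j + (c + \<kappa> * d) * u $ j"
        by (simp add: algebra_simps)
      then show "(fmax ?\<sigma> vopt + (\<kappa> * d) \<cdot>\<^sub>v u) $ j \<le> (vopt + d \<cdot>\<^sub>v u) $ j"
        using j vopt unfolding d_eq by simp
    qed (use vopt in auto)
    finally show "fmax ?\<sigma> (vopt + d \<cdot>\<^sub>v u) \<le> vopt + d \<cdot>\<^sub>v u" .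
  qed (use \<sigma> in \<open>auto intro: contracting_fmax\<close>)
  \<comment> \<open>Each improvement goes at least as far as one application of \<open>f\<close>,
    which shrinks the distance to \<open>vopt\<close> by the factor \<open>\<kappa>\<close>.\<close>
  have dist: "min_val (p (t + k)) \<le> vopt + (\<kappa> ^ k * d) \<cdot>\<^sub>v u" if "t + k \<le> s" for k
    using that
  proof (induction k)
    case 0
    show ?case using dist0 by simp
  next
    case (Suc k)
    then have tk: "t + k < s" by simp
    have "min_val (p (t + Suc k)) \<le> f (min_val (p (t + k)))"
      using improves(3)[OF P[of "t + k"] imp[OF tk]] tk by simp
    also have "\<dots> \<le> f vopt + (\<kappa> * (\<kappa> ^ k * d)) \<cdot>\<^sub>v u"
      using Suc tk vopt d0 kappa_pos min_val(1)[OF P[of "t + k"]]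
      by (intro contractingD[OF contracting_f]) auto
    finally show ?case using vopt by (simp add: mult_ac)
  qed
  show ?thesis
  proof (intro exI[of _ i] conjI allI impI i(1) notI)
    fix k assume k: "K \<le> k" "t + k \<le> s" and same: "p (t + k) i = ?\<sigma> i"
    let ?\<tau> = "p (t + k)"
    have \<tau>: "?\<tau> \<in> P" using P k by simp
    \<comment> \<open>With the same action at \<open>i\<close>, the later policy still has residual
      \<open>c * u $ i\<close> there. By monotonicity this is at most the distance of its value to
      \<open>vopt\<close>, hence too small.\<close>
    have "vopt $ i + c * u $ i = fmax ?\<sigma> vopt $ i"
      using i u_pos[OF i(1)] by (simp add: res_def)
    also have "\<dots> = fmax ?\<tau> vopt $ i"
      using \<sigma> \<tau> vopt i same by (simp add: fmax_index)
    also have "\<dots> \<le> fmax ?\<tau> (min_val ?\<tau>) $ i"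
      using contracting_mono[OF contracting_fmax[OF \<tau>] vopt(1) min_val(1)[OF \<tau>] vopt_le_min_val[OF \<tau>]] i
      by (simp add: vec_le_iff[of _ n])
    also have "\<dots> = min_val ?\<tau> $ i" using min_val[OF \<tau>] by simp
    also have "\<dots> \<le> vopt $ i + \<kappa> ^ k * d * u $ i"
      using dist[OF k(2)] i min_val[OF \<tau>] vopt by (simp add: vec_le_iff[of _ n])
    finally have "c \<le> \<kappa> ^ k * d" using u_pos[OF i(1)] by simp
    also have "\<dots> \<le> \<kappa> ^ K * d"
      using d0 k kappa_pos kappa_less_1 by (intro mult_right_mono power_decreasing) auto
    also have "\<dots> < (1 - \<kappa>) * d" using K d0 by simp
    also have "\<dots> = c" using kappa_less_1 by (simp add: d_def)
    finally show False by simp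
  qed
qed

lemma state_actions_eq: "{(i, a). i < n \<and> a \<in> As i} = (SIGMA i:{..<n}. As i)"
  by auto

lemma finite_state_actions: "finite {(i, a). i < n \<and> a \<in> As i}"
  unfolding state_actions_eq using As by (intro finite_SigmaI) auto

text \<open>Ensures that the truncated subtraction of \<open>n\<close> is a true one.\<close>

lemma card_state_actions_ge: "n \<le> card {(i, a). i < n \<and> a \<in> As i}"
proof -
  have "(\<Sum>i<n. 1) \<le> (\<Sum>i<n. card (As i))"
    using As by (intro sum_mono) (simp add: Suc_le_eq card_gt_0_iff)
  then show ?thesis
    unfolding state_actions_eq using As by (subst card_SigmaI) auto
qed

text \<open>The policies at times \<open>j * K\<close> with \<open>j < m\<close> each lose a
  state-action pair for good, and these pairs are distinct. From time \<open>m * K\<close> on just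
  \<open>n\<close> pairs remain, which determine the policy, so no further change is
  possible.\<close>

lemma external_iterations_bound:
  assumes P: "\<And>t. t \<le> s \<Longrightarrow> p t \<in> P"
    and imp: "\<And>t. t < s \<Longrightarrow> improves (p t) (p (Suc t))"
    and K: "K > 0" "\<kappa> ^ K < 1 - \<kappa>"
  shows "s \<le> (card {(i, a). i < n \<and> a \<in> As i} - n) * K"
proof (rule ccontr)
  define E where "E = {(i, a). i < n \<and> a \<in> As i}"
  define m where "m = card E - n"
  assume "\<not> ?thesis"
  then have sK: "m * K < s" by (simp add: m_def E_def)
  have finE: "finite E" unfolding E_def by (rule finite_state_actions)
  have "\<forall>j. \<exists>i. j < m \<longrightarrow> i < n \<and> (\<forall>k\<ge>K. j * K + k \<le> s \<longrightarrow> p (j * K + k) i \<noteq> p (j * K) i)"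
  proof
    fix j
    show "\<exists>i. j < m \<longrightarrow> i < n \<and> (\<forall>k\<ge>K. j * K + k \<le> s \<longrightarrow> p (j * K + k) i \<noteq> p (j * K) i)"
    proof (cases "j < m")
      case True
      then have "Suc j * K \<le> m * K" by (intro mult_right_mono) auto
      then have "j * K + K \<le> s" using sK by simp
      from action_eliminated[of s p K "j * K", OF P imp K this] show ?thesis by blast
    qed auto
  qed
  from choice[OF this] obtain e where e: "\<And>j. j < m \<Longrightarrow> e j < n"
    and elim: "\<And>j k. j < m \<Longrightarrow> K \<le> k \<Longrightarrow> j * K + k \<le> s \<Longrightarrow> p (j * K + k) (e j) \<noteq> p (j * K) (e j)"
    by blast
  have elim': "p t (e j) \<noteq> p (j * K) (e j)" if "j < m" "Suc j * K \<le> t" "t \<le> s" for j t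
    using elim[of j "t - j * K"] that by simp
  define g where "g j = (e j, p (j * K) (e j))" for j
  define graph where "graph t = (\<lambda>i. (i, p t i)) ` {..<n}" for t
  have jK: "Suc j * K \<le> m * K" if "j < m" for j
    using that by (intro mult_right_mono) auto
  \<comment> \<open>The pair of a later block is in use at time \<open>l * K\<close>, when the pair
    of block \<open>j < l\<close> has already been eliminated.\<close>
  have inj: "inj_on g {..<m}"
  proof (rule inj_onI, rule ccontr)
    have aux: "g j \<noteq> g l" if "j < l" "l < m" for j l
    proof
      assume eq: "g j = g l"
      have "Suc j * K \<le> l * K" using that by (intro mult_right_mono) auto
      moreover have "l * K \<le> s" using jK[OF that(2)] sK by simp
      ultimately show False using elim'[of j "l * K"] that eq by (auto simp: g_def)
    qed
    fix j l assume "j \<in> {..<m}" "l \<in> {..<m}" "g j = g l" "j \<noteq> l"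
    then show False using aux[of j l] aux[of l j] by (cases "j < l") auto
  qed
  have gE: "g ` {..<m} \<subseteq> E"
  proof
    fix x assume "x \<in> g ` {..<m}"
    then obtain j where j: "j < m" "x = g j" by auto
    have "p (j * K) \<in> P" using jK[OF j(1)] sK by (intro P) simp
    then show "x \<in> E" using j e min_policyD by (auto simp: g_def E_def)
  qed
  have graphE: "graph t \<subseteq> E" if "t \<le> s" for t
    using P[OF that] min_policyD by (auto simp: graph_def E_def)
  have card_graph: "card (graph t) = n" for t
    unfolding graph_def by (subst card_image) (auto simp: inj_on_def)
  \<comment> \<open>The graph of a policy has \<open>n\<close> elements, as many as survive the
    eliminations, so inclusion forces equality.\<close>
  have graph_eq: "graph t = E - g ` {..<m}" if t: "m * K \<le> t" "t \<le> s" for t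
  proof (rule card_subset_eq)
    have "(e j, p (j * K) (e j)) \<notin> graph t" if "j < m" for j
      using elim'[of j t] that t jK[OF that] by (auto simp: graph_def)
    then show sub: "graph t \<subseteq> E - g ` {..<m}" using graphE[OF t(2)] by (auto simp: g_def)
    have nE: "n \<le> card E" unfolding E_def by (rule card_state_actions_ge)
    have "card (E - g ` {..<m}) = card E - m"
      using inj gE finE by (simp add: card_Diff_subset card_image finite_subset)
    then show "card (graph t) = card (E - g ` {..<m})"
      using nE card_graph by (simp add: m_def)
  qed (use finE in auto)
  \<comment> \<open>As \<open>m * K < s\<close> is strict, the next iteration is still within range
    and its policy must differ.\<close>
  let ?t = "m * K"
  have "graph ?t = graph (Suc ?t)" using graph_eq[of ?t] graph_eq[of "Suc ?t"] sK by simp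
  then have "p ?t i = p (Suc ?t) i" if "i < n" for i
    using that by (auto simp: graph_def set_eq_iff image_iff)
  moreover have "p ?t \<in> P" "p (Suc ?t) \<in> P" using P sK by auto
  ultimately have "p ?t = p (Suc ?t)"
    by (intro PiE_ext[of _ "{..<n}" "\<lambda>_. A"]) (auto simp: min_policies_def)
  then show False using imp[OF sK] by (simp add: improves_def)
qed

end

section \<open>Finiteness and counting for termination\<close>

text \<open>Only the values \<open>\<delta> (i, \<sigma> i)\<close> matter, and there are finitely many of them even where
  \<open>max_policies\<close> is infinite.\<close>

lemma finite_image_max_policies:
  fixes g :: "real mat \<Rightarrow> real vec \<Rightarrow> 'c"
  assumes Bs: "\<And>i. i < n \<Longrightarrow> finite (Bs i)" and \<sigma>: "\<And>i. i < n \<Longrightarrow> \<sigma> i \<in> A"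
  shows "finite ((\<lambda>\<delta>. g (policy_mat n M \<sigma> \<delta>) (policy_vec n r \<sigma> \<delta>)) ` max_policies n A B Bs)"
proof (rule finite_subset)
  \<comment> \<open>Extends a choice per coordinate to all actions. The result need not be
    extensional; only its matrix and vector matter.\<close>
  let ?h = "\<lambda>\<rho>. \<lambda>(i, a). \<rho> (i :: nat)"
  show "(\<lambda>\<delta>. g (policy_mat n M \<sigma> \<delta>) (policy_vec n r \<sigma> \<delta>)) ` max_policies n A B Bs
    \<subseteq> (\<lambda>\<rho>. g (policy_mat n M \<sigma> (?h \<rho>)) (policy_vec n r \<sigma> (?h \<rho>))) ` Pi\<^sub>E {..<n} Bs"
  proof (rule image_subsetI)
    fix \<delta> assume \<delta>: "\<delta> \<in> max_policies n A B Bs"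
    define \<rho> where "\<rho> = restrict (\<lambda>i. \<delta> (i, \<sigma> i)) {..<n}"
    have "policy_mat n M \<sigma> \<delta> = policy_mat n M \<sigma> (?h \<rho>)"
      by (rule eq_matI) (auto simp: policy_mat_def \<rho>_def)
    moreover have "policy_vec n r \<sigma> \<delta> = policy_vec n r \<sigma> (?h \<rho>)"
      by (rule eq_vecI) (auto simp: policy_vec_def \<rho>_def)
    moreover have "\<rho> \<in> Pi\<^sub>E {..<n} Bs"
      using \<delta> \<sigma> by (auto simp: \<rho>_def max_policies_def)
    ultimately show "g (policy_mat n M \<sigma> \<delta>) (policy_vec n r \<sigma> \<delta>)
      \<in> (\<lambda>\<rho>. g (policy_mat n M \<sigma> (?h \<rho>)) (policy_vec n r \<sigma> (?h \<rho>))) ` Pi\<^sub>E {..<n} Bs"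
      by (intro image_eqI[of _ _ \<rho>]) simp_all
  qed
  show "finite ((\<lambda>\<rho>. g (policy_mat n M \<sigma> (?h \<rho>)) (policy_vec n r \<sigma> (?h \<rho>))) ` Pi\<^sub>E {..<n} Bs)"
    using Bs by (intro finite_imageI finite_PiE) auto
qed

lemma finite_min_policies:
  assumes "\<And>i. i < n \<Longrightarrow> finite (As i)"
  shows "finite (min_policies n A As)"
proof (rule finite_subset)
  show "min_policies n A As \<subseteq> Pi\<^sub>E {..<n} As" by (auto simp: min_policies_def)
  show "finite (Pi\<^sub>E {..<n} As)" using assms by (intro finite_PiE) auto
qed

text \<open>Counting the elements of a finite set beyond the current one turns a strict ascent into
  a strict descent of natural numbers.\<close>

lemma card_greater_less_card_greater:
  fixes x y :: "'a :: order"
  assumes "finite S" "y \<in> S" "x < y"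
  shows "card {z \<in> S. y < z} < card {z \<in> S. x < z}"
  using assms by (intro psubset_card_mono) auto

lemma card_less_less_card_less:
  fixes x y :: "'a :: order"
  assumes "finite S" "y \<in> S" "y < x"
  shows "card {z \<in> S. z < y} < card {z \<in> S. z < x}"
  using assms by (intro psubset_card_mono) auto

text \<open>If the current policy already attains \<open>F v\<close> it is the next one; otherwise
  the keeping clause is vacuous and any attaining policy will do.\<close>

lemma improve_step_exists:
  assumes "p \<in> Q" "\<exists>p'\<in>Q. F v = Fp p' v"
  shows "\<exists>y. improve_step Q F Fp (Improve s p v) y"
proof -
  obtain p' where "next_policy Q F Fp p v p'"
    using assms by (auto simp: next_policy_def)
  then show ?thesis
    by (cases "p' = p") (auto intro: improve_step.intros)
qed

section \<open>Invariant and ranking of the transition system\<close>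

context contracting_game
begin

text \<open>Records the whole history of improving policies, since the bound on \<open>s\<close>
  concerns the sequence and not just its last member.\<close>

definition reached :: "nat \<Rightarrow> (nat \<Rightarrow> 'a) \<Rightarrow> bool" where
  "reached s \<sigma> \<longleftrightarrow> (\<exists>p. p s = \<sigma> \<and> (\<forall>t\<le>s. p t \<in> P) \<and> (\<forall>t<s. improves (p t) (p (Suc t))))"

lemma reached_0: "\<sigma> \<in> P \<Longrightarrow> reached 0 \<sigma>"
  unfolding reached_def by (rule exI[of _ "\<lambda>_. \<sigma>"]) simp

lemma reached_Suc:
  assumes "reached s \<sigma>" "improves \<sigma> \<sigma>'"
  shows "reached (Suc s) \<sigma>'"
proof -
  from assms obtain p where p: "p s = \<sigma>" "\<forall>t\<le>s. p t \<in> P" "\<forall>t<s. improves (p t) (p (Suc t))"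
    by (auto simp: reached_def)
  moreover have "\<sigma>' \<in> P" using improves(1)[OF _ assms(2)] p by auto
  ultimately show ?thesis
    unfolding reached_def using assms(2)
    by (intro exI[of _ "p(Suc s := \<sigma>')"]) (auto simp: le_Suc_eq less_Suc_eq)
qed

lemma reached_policy: "reached s \<sigma> \<Longrightarrow> \<sigma> \<in> P"
  by (auto simp: reached_def)

lemma reached_bound:
  assumes "reached s \<sigma>" "K > 0" "\<kappa> ^ K < 1 - \<kappa>"
  shows "s \<le> (card {(i, a). i < n \<and> a \<in> As i} - n) * K"
proof -
  from assms(1) obtain p where "\<forall>t\<le>s. p t \<in> P" "\<forall>t<s. improves (p t) (p (Suc t))"
    by (auto simp: reached_def)
  then show ?thesis using assms by (intro external_iterations_bound[of s p]) auto
qed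

fun internal_ok :: "(nat \<Rightarrow> 'a) \<Rightarrow> (nat \<times> 'a \<Rightarrow> 'b, real vec) pi_state \<Rightarrow> bool" where
  "internal_ok \<sigma> (Evaluate k \<delta>) \<longleftrightarrow> \<delta> \<in> D"
| "internal_ok \<sigma> (Improve k \<delta> v) \<longleftrightarrow> \<delta> \<in> D \<and> v = max_val \<sigma> \<delta>"
| "internal_ok \<sigma> (Stopped k \<delta> v) \<longleftrightarrow> v = min_val \<sigma>"

fun state_ok :: "('a, 'b) two_player_state \<Rightarrow> bool" where
  "state_ok (External (Evaluate s \<sigma>)) \<longleftrightarrow> reached s \<sigma>"
| "state_ok (External (Improve s \<sigma> v)) \<longleftrightarrow> reached s \<sigma> \<and> v = min_val \<sigma>"
| "state_ok (External (Stopped s \<sigma> v)) \<longleftrightarrow> reached s \<sigma>"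
| "state_ok (Internal s \<sigma> x) \<longleftrightarrow> reached s \<sigma> \<and> internal_ok \<sigma> x"

definition vsum :: "real vec \<Rightarrow> real" where
  "vsum v = (\<Sum>i<n. v $ i)"

text \<open>Counts attainable values rather than policies: the set of policies may be infinite, the
  set of values is not.\<close>

definition max_rank :: "(nat \<Rightarrow> 'a) \<Rightarrow> (nat \<times> 'a \<Rightarrow> 'b) \<Rightarrow> nat" where
  "max_rank \<sigma> \<delta> = card {z \<in> (\<lambda>\<delta>. vsum (max_val \<sigma> \<delta>)) ` D. vsum (max_val \<sigma> \<delta>) < z}"

definition min_rank :: "(nat \<Rightarrow> 'a) \<Rightarrow> nat" where
  "min_rank \<sigma> = card {z \<in> (\<lambda>\<sigma>. vsum (min_val \<sigma>)) ` P. z < vsum (min_val \<sigma>)}"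

lemma max_rank_decreases:
  assumes "\<sigma> \<in> P" "\<delta> \<in> D"
    "next_policy D (fmax \<sigma>) (faff \<sigma>) \<delta> (max_val \<sigma> \<delta>) \<delta>'" "\<delta>' \<noteq> \<delta>"
  shows "max_rank \<sigma> \<delta>' < max_rank \<sigma> \<delta>"
  unfolding max_rank_def
proof (rule card_greater_less_card_greater)
  have \<delta>': "\<delta>' \<in> D" using assms(3) by (simp add: next_policy_def)
  then show "vsum (max_val \<sigma> \<delta>') \<in> (\<lambda>\<delta>. vsum (max_val \<sigma> \<delta>)) ` D" by simp
  show "vsum (max_val \<sigma> \<delta>) < vsum (max_val \<sigma> \<delta>')"
    unfolding vsum_def using max_val(1) assms \<delta>' max_val_improves[OF assms]
    by (intro sum_vec_mono_strict) auto
  \<comment> \<open>Unfolded, the value depends on \<open>\<delta>\<close> through its matrix and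
    reward vector only.\<close>
  show "finite ((\<lambda>\<delta>. vsum (max_val \<sigma> \<delta>)) ` D)"
    unfolding max_val_def affine_map_def using Bs min_policyD(2)[OF assms(1)]
    by (intro finite_image_max_policies[of n Bs \<sigma> A "\<lambda>m b. vsum (fixpoint (\<lambda>v. m *\<^sub>v v + b))"]) auto
qed

lemma min_rank_decreases:
  assumes "\<sigma> \<in> P" "improves \<sigma> \<sigma>'"
  shows "min_rank \<sigma>' < min_rank \<sigma>"
  unfolding min_rank_def
proof (rule card_less_less_card_less)
  note \<sigma>' = improves[OF assms]
  then show "vsum (min_val \<sigma>') \<in> (\<lambda>\<sigma>. vsum (min_val \<sigma>)) ` P" by simp
  show "vsum (min_val \<sigma>') < vsum (min_val \<sigma>)"
    unfolding vsum_def using min_val(1) assms \<sigma>' by (intro sum_vec_mono_strict) auto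
  show "finite ((\<lambda>\<sigma>. vsum (min_val \<sigma>)) ` P)"
    using As by (intro finite_imageI finite_min_policies) auto
qed

text \<open>The factor 2 leaves room for the state between two evaluations: \<open>Evaluate\<close>
  to \<open>Improve\<close> costs one, and a drop of \<open>max_rank\<close> pays for the way
  back.\<close>

fun internal_rank :: "(nat \<Rightarrow> 'a) \<Rightarrow> (nat \<times> 'a \<Rightarrow> 'b, real vec) pi_state \<Rightarrow> nat" where
  "internal_rank \<sigma> (Evaluate k \<delta>) = 2 * max_rank \<sigma> \<delta> + 2"
| "internal_rank \<sigma> (Improve k \<delta> v) = 2 * max_rank \<sigma> \<delta> + 1"
| "internal_rank \<sigma> (Stopped k \<delta> v) = 0"

text \<open>First component of a lexicographic order: \<open>min_rank\<close> drops when the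
  external policy changes, the phase drops between such changes, and \<open>internal_rank\<close>
  drops within an internal run.\<close>

fun policy_rank :: "('a, 'b) two_player_state \<Rightarrow> nat" where
  "policy_rank (External (Evaluate s \<sigma>)) = min_rank \<sigma>"
| "policy_rank (External (Improve s \<sigma> v)) = min_rank \<sigma>"
| "policy_rank (External (Stopped s \<sigma> v)) = min_rank \<sigma>"
| "policy_rank (Internal s \<sigma> x) = min_rank \<sigma>"

fun phase_rank :: "('a, 'b) two_player_state \<Rightarrow> nat" where
  "phase_rank (External (Evaluate s \<sigma>)) = 3"
| "phase_rank (Internal s \<sigma> x) = 2"
| "phase_rank (External (Improve s \<sigma> v)) = 1"
| "phase_rank (External (Stopped s \<sigma> v)) = 0"

fun evaluation_rank :: "('a, 'b) two_player_state \<Rightarrow> nat" where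
  "evaluation_rank (Internal s \<sigma> x) = internal_rank \<sigma> x"
| "evaluation_rank (External x) = 0"

abbreviation "step \<equiv> two_player_step n A As B Bs M r"

text \<open>The stopping test gives correctness: a kept policy satisfies
  \<open>fmax \<sigma> v = faff \<sigma> \<delta> v = v\<close>, so \<open>v\<close> is the fixed
  point of \<open>fmax \<sigma>\<close>.\<close>

lemma internal_step_ok:
  assumes step: "internal_step n A B Bs M r \<sigma> x y" and \<sigma>: "\<sigma> \<in> P" and ok: "internal_ok \<sigma> x"
  shows "internal_ok \<sigma> y \<and> internal_rank \<sigma> y < internal_rank \<sigma> x"
  using step
proof cases
  case (solve v \<delta> k)
  then have "max_val \<sigma> \<delta> = v"
    using ok \<sigma> unfolding max_val_def by (intro fixpoint_eqI contracting_faff) auto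
  with solve ok show ?thesis by simp
next
  case improve
  then show ?thesis
  proof cases
    case (continue \<delta> v \<delta>' k)
    then show ?thesis
      using ok max_rank_decreases[OF \<sigma>, of \<delta> \<delta>'] by (auto simp: next_policy_def)
  next
    case (stop \<delta> v \<delta>' k)
    then have \<delta>: "\<delta> \<in> D" and v: "v = max_val \<sigma> \<delta>" and "fmax \<sigma> v = faff \<sigma> \<delta> v"
      using ok by (auto simp: next_policy_def)
    then have "fmax \<sigma> v = v" "v \<in> carrier_vec n" using max_val[OF \<sigma> \<delta>] by auto
    then have "min_val \<sigma> = v"
      unfolding min_val_def using \<sigma> by (intro fixpoint_eqI contracting_fmax) auto
    with stop show ?thesis by simp
  qed
qed

lemma step_ok:
  assumes step: "step x y" and ok: "state_ok x"
  shows "state_ok y \<and> (y, x) \<in> measures [policy_rank, phase_rank, evaluation_rank]"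
  using step
proof cases
  case (run_internal \<sigma> x' y' s)
  then show ?thesis using ok internal_step_ok[of \<sigma> x' y'] reached_policy by auto
next
  case (improve_external x' y')
  from improve_external(3) show ?thesis
  proof cases
    case (continue \<sigma> v \<sigma>' s)
    then have reached: "reached s \<sigma>" and imp: "improves \<sigma> \<sigma>'"
      using improve_external ok by (auto simp: improves_def)
    then show ?thesis
      using improve_external continue reached_Suc[OF reached imp]
        min_rank_decreases[OF reached_policy[OF reached] imp] by auto
  next
    case stop
    then show ?thesis using improve_external ok by auto
  qed
qed (use ok in auto)

text \<open>Fixed points of the affine maps and greedy policies at both levels always exist, so
  every other state has a successor.\<close>

lemma step_progress:
  assumes ok: "state_ok x" and halt: "\<nexists>y. step x y"
  shows "\<exists>s \<sigma> v. x = External (Stopped s \<sigma> v)"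
proof (cases x rule: state_ok.cases)
  case (1 s \<sigma>)
  have "D \<noteq> {}" using max_policy_exists[of "\<lambda>i. SOME b. b \<in> Bs i"] Bs by (auto simp: some_in_eq)
  then show ?thesis using halt 1 call_internal by fastforce
next
  case (2 s \<sigma> v)
  then have \<sigma>: "\<sigma> \<in> P" using ok reached_policy by auto
  have "\<exists>y. improve_step P f fmax (Improve s \<sigma> v) y"
    using 2 ok min_val(1)[OF \<sigma>]
    by (intro improve_step_exists \<sigma> greedy_min_policy_exists) auto
  then show ?thesis using halt 2 improve_external by fast
next
  case (4 s \<sigma> x')
  then have \<sigma>: "\<sigma> \<in> P" and ok': "internal_ok \<sigma> x'" using ok reached_policy by auto
  have "\<exists>y. step (Internal s \<sigma> x') y"
  proof (cases x')
    case (Evaluate k \<delta>)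
    then have "internal_step n A B Bs M r \<sigma> x' (Improve k \<delta> (max_val \<sigma> \<delta>))"
      using max_val[OF \<sigma>] ok' by (auto intro: solve)
    then show ?thesis using run_internal by fast
  next
    case (Improve k \<delta> v)
    then have "\<exists>y. improve_step D (fmax \<sigma>) (faff \<sigma>) x' y"
      using ok' max_val(1)[OF \<sigma>] unfolding Improve
      by (intro improve_step_exists greedy_max_policy_exists \<sigma>) auto
    then show ?thesis using run_internal improve by fast
  next
    case (Stopped k \<delta> v)
    then show ?thesis using return_internal by fast
  qed
  with halt 4 show ?thesis by simp
qed blast

theorem stops_within:
  assumes K: "K > 0" "\<kappa> ^ K < 1 - \<kappa>"
  shows "two_player_pi_stops_within n A As B Bs M r
    (int ((card {(i, a). i < n \<and> a \<in> As i} - n) * K))"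
  unfolding two_player_pi_stops_within_def
proof (intro ballI conjI notI allI impI)
  fix \<sigma> assume \<sigma>: "\<sigma> \<in> P"
  let ?x0 = "External (Evaluate 0 \<sigma>)"
  have ok0: "state_ok ?x0" using reached_0[OF \<sigma>] by simp
  show False if c: "\<exists>c. c 0 = ?x0 \<and> (\<forall>k. step (c k) (c (Suc k)))"
  proof -
    from c obtain c where c: "c 0 = ?x0" "\<And>k. step (c k) (c (Suc k))" by blast
    have ok: "state_ok (c k)" for k
      by (induction k) (use ok0 c step_ok in auto)
    have "wf (measures [policy_rank, phase_rank, evaluation_rank])" by (rule wf_measures)
    then show False
      unfolding wf_iff_no_infinite_down_chain using step_ok[OF c(2) ok] by blast
  qed
  fix x assume x: "step\<^sup>*\<^sup>* ?x0 x \<and> (\<nexists>y. step x y)"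
  then have "step\<^sup>*\<^sup>* ?x0 x" by simp
  then have ok: "state_ok x"
    by induction (use ok0 step_ok in auto)
  then obtain s \<sigma>' v where xs: "x = External (Stopped s \<sigma>' v)"
    using step_progress x by blast
  then have "reached s \<sigma>'" using ok by simp
  from reached_bound[OF this K]
  have "int s \<le> int ((card {(i, a). i < n \<and> a \<in> As i} - n) * K)"
    by (rule of_nat_mono)
  with xs show "\<exists>s \<sigma>' v. x = External (Stopped s \<sigma>' v) \<and>
      int s \<le> int ((card {(i, a). i < n \<and> a \<in> As i} - n) * K)" by blast
qed

end

section \<open>Choice of the contraction factor and conclusion\<close>

text \<open>\<open>K\<close> strictly exceeds the quotient and \<open>ln \<omega>\<close> is
  negative, so \<open>\<omega> ^ K < 1 - \<omega>\<close>. The inequality is strict and both sides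
  are continuous, so it persists slightly to the right of \<open>\<omega>\<close>.\<close>

lemma ex_contraction_factor:
  fixes \<omega> :: real
  assumes \<omega>: "0 \<le> \<omega>" "\<omega> < 1"
  defines "K \<equiv> nat (1 + \<lfloor>if \<omega> = 0 then 0 else ln (1 - \<omega>) / ln \<omega>\<rfloor>)"
  shows "int K = 1 + \<lfloor>if \<omega> = 0 then 0 else ln (1 - \<omega>) / ln \<omega>\<rfloor>" "K > 0"
    "\<exists>\<kappa>. \<omega> < \<kappa> \<and> \<kappa> < 1 \<and> \<kappa> ^ K < 1 - \<kappa>"
proof -
  let ?q = "if \<omega> = 0 then 0 else ln (1 - \<omega>) / ln \<omega>"
  have "?q \<ge> 0" using \<omega> by (auto intro!: divide_nonpos_nonpos)
  then have "\<lfloor>?q\<rfloor> \<ge> 0" by (simp only: zero_le_floor)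
  then show intK: "int K = 1 + \<lfloor>?q\<rfloor>" and K: "K > 0" unfolding K_def by linarith+
  have pow: "\<omega> ^ K < 1 - \<omega>"
  proof (cases "\<omega> = 0")
    case False
    then have \<omega>0: "\<omega> > 0" and ln: "ln \<omega> < 0" using \<omega> by auto
    have "real K = 1 + real_of_int \<lfloor>?q\<rfloor>" using intK by linarith
    then have "ln (1 - \<omega>) / ln \<omega> < real K" using False by simp linarith
    then have "real K * ln \<omega> < ln (1 - \<omega>)" using ln by (simp add: neg_divide_less_eq)
    then have "ln (\<omega> ^ K) < ln (1 - \<omega>)" using \<omega>0 by (simp add: ln_realpow)
    then show ?thesis using \<omega>0 \<omega> by simp
  qed (use K in \<open>simp add: power_0_left\<close>)
  have "((\<lambda>x. x ^ K - (1 - x)) \<longlongrightarrow> \<omega> ^ K - (1 - \<omega>)) (at_right \<omega>)"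
    by (intro tendsto_intros)
  then have "\<forall>\<^sub>F x in at_right \<omega>. x ^ K - (1 - x) < 0"
    using pow by (intro order_tendstoD) auto
  moreover have "\<forall>\<^sub>F x in at_right \<omega>. x \<in> {\<omega><..<1}"
    using \<omega> by (intro eventually_at_right_real)
  ultimately have "\<forall>\<^sub>F x in at_right \<omega>. \<omega> < x \<and> x < 1 \<and> x ^ K < 1 - x"
    by eventually_elim auto
  then show "\<exists>\<kappa>. \<omega> < \<kappa> \<and> \<kappa> < 1 \<and> \<kappa> ^ K < 1 - \<kappa>"
    using eventually_happens' trivial_limit_at_right_real by blast
qed

theorem corollary10:
  fixes n :: nat
    and A :: "'a set" and As :: "nat \<Rightarrow> 'a set"
    and B :: "'b set" and Bs :: "nat \<Rightarrow> 'b set"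
    and M :: "'a \<Rightarrow> 'b \<Rightarrow> nat \<Rightarrow> nat \<Rightarrow> real"
    and r :: "'a \<Rightarrow> 'b \<Rightarrow> nat \<Rightarrow> real"
    and \<omega> :: real and m1 :: nat
  assumes "n \<ge> 1"
    and "\<And>i. i < n \<Longrightarrow> finite (As i) \<and> As i \<noteq> {} \<and> As i \<subseteq> A"
    and "\<And>i. i < n \<Longrightarrow> finite (Bs i) \<and> Bs i \<noteq> {} \<and> Bs i \<subseteq> B"
    and "\<And>i j a b. i < n \<Longrightarrow> j < n \<Longrightarrow> a \<in> As i \<Longrightarrow> b \<in> Bs i \<Longrightarrow> M a b i j \<ge> 0"
    and "\<And>\<sigma> \<delta>. \<sigma> \<in> min_policies n A As \<Longrightarrow> \<delta> \<in> max_policies n A B Bs \<Longrightarrow>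
           policy_radius n M \<sigma> \<delta> < 1"
  defines "\<omega> \<equiv> Max {policy_radius n M \<sigma> \<delta> | \<sigma> \<delta>.
                    \<sigma> \<in> min_policies n A As \<and> \<delta> \<in> max_policies n A B Bs}"
    and "m1 \<equiv> card {(i, a). i < n \<and> a \<in> As i}"
  shows "two_player_pi_stops_within n A As B Bs M r
           ((int m1 - int n) * (1 + \<lfloor>if \<omega> = 0 then 0 else ln (1 - \<omega>) / ln \<omega>\<rfloor>))"
proof -
  note As = assms(2) and Bs = assms(3)
  have n: "n > 0" using assms(1) by simp
  let ?P = "min_policies n A As" and ?D = "max_policies n A B Bs"
  define S where "S = {policy_radius n M \<sigma> \<delta> | \<sigma> \<delta>. \<sigma> \<in> ?P \<and> \<delta> \<in> ?D}"
  have \<omega>S: "\<omega> = Max S" by (simp add: \<omega>_def S_def)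
  have S_eq: "S = (\<Union>\<sigma>\<in>?P. (\<lambda>\<delta>. policy_radius n M \<sigma> \<delta>) ` ?D)" by (auto simp: S_def)
  have PA: "\<sigma> i \<in> A" if "\<sigma> \<in> ?P" "i < n" for \<sigma> i
    using that by (auto simp: min_policies_def)
  \<comment> \<open>The radius depends on the matrix alone, and only finitely many matrices occur,
    so the maximum is attained.\<close>
  have finS: "finite S"
    unfolding S_eq policy_radius_def using As Bs PA
    by (intro finite_UN_I finite_min_policies
        finite_image_max_policies[where g = "\<lambda>m _. spectral_radius (map_mat complex_of_real m)"]) auto
  \<comment> \<open>As \<open>\<delta>\<close> ignores the action, \<open>a\<close> and
    \<open>b\<close> can be prescribed independently.\<close>
  have policies: "\<exists>\<sigma>\<in>?P. \<exists>\<delta>\<in>?D. \<forall>i<n. \<sigma> i = a i \<and> \<delta> (i, a i) = b i"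
    if "\<And>i. i < n \<Longrightarrow> a i \<in> As i" "\<And>i. i < n \<Longrightarrow> b i \<in> Bs i" for a b
    using that subsetD[OF As[THEN conjunct2, THEN conjunct2]] subsetD[OF Bs[THEN conjunct2, THEN conjunct2]]
    by (intro bexI[of _ "restrict a {..<n}"] bexI[of _ "restrict (b \<circ> fst) ({..<n} \<times> A)"])
      (auto simp: min_policies_def max_policies_def)
  have "S \<noteq> {}"
    using policies[of "\<lambda>i. SOME a. a \<in> As i" "\<lambda>i. SOME b. b \<in> Bs i"] As Bs
    by (auto simp: S_def some_in_eq)
  then have "\<omega> \<in> S" unfolding \<omega>S using finS by simp
  then have \<omega>1: "\<omega> < 1" and \<omega>0: "0 \<le> \<omega>"
    using assms(5) by (auto simp: S_def policy_radius_def policy_mat_def intro!: spectral_radius_nonneg n)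
  define K where "K = nat (1 + \<lfloor>if \<omega> = 0 then 0 else ln (1 - \<omega>) / ln \<omega>\<rfloor>)"
  note K = ex_contraction_factor[OF \<omega>0 \<omega>1, folded K_def]
  from K(3) obtain \<kappa> where \<kappa>: "\<omega> < \<kappa>" "\<kappa> < 1" "\<kappa> ^ K < 1 - \<kappa>" by blast
  \<comment> \<open>A row choice is a pair of actions per coordinate. A pair of policies realizes
    it, so its radius is at most \<open>\<omega>\<close>, strictly below
    \<open>\<kappa>\<close>.\<close>
  have "\<exists>u. (\<forall>i<n. u i > 0) \<and>
    (\<forall>i<n. \<forall>c\<in>As i \<times> Bs i. (\<Sum>j<n. M (fst c) (snd c) i j * u j) \<le> \<kappa> * u i)"
  proof (rule common_weight_exists[OF n])
    fix c assume c: "c \<in> Pi\<^sub>E {..<n} (\<lambda>i. As i \<times> Bs i)"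
    then obtain \<sigma> \<delta> where p: "\<sigma> \<in> ?P" "\<delta> \<in> ?D"
      "\<forall>i<n. \<sigma> i = fst (c i) \<and> \<delta> (i, fst (c i)) = snd (c i)"
      using policies[of "\<lambda>i. fst (c i)" "\<lambda>i. snd (c i)"] by (fastforce simp: PiE_iff mem_Times_iff)
    have "mat n n (\<lambda>(i, j). M (fst (c i)) (snd (c i)) i j) = policy_mat n M \<sigma> \<delta>"
      using p by (intro eq_matI) (auto simp: policy_mat_def)
    moreover have "policy_radius n M \<sigma> \<delta> \<le> \<omega>"
      unfolding \<omega>S using p finS by (intro Max_ge) (auto simp: S_def)
    ultimately show "spectral_radius (map_mat complex_of_real
        (mat n n (\<lambda>(i, j). M (fst (c i)) (snd (c i)) i j))) < \<kappa>"
      using \<kappa> by (simp add: policy_radius_def)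
  qed (use As Bs assms(4) \<kappa> \<omega>0 in auto)
  then obtain u where u: "\<And>i. i < n \<Longrightarrow> u i > 0"
    "\<And>i a b. i < n \<Longrightarrow> a \<in> As i \<Longrightarrow> b \<in> Bs i \<Longrightarrow> (\<Sum>j<n. M a b i j * u j) \<le> \<kappa> * u i"
    by fastforce
  interpret contracting_game n "vec n u" \<kappa> A As B Bs M r
    by unfold_locales (use As Bs assms(4) \<kappa> \<omega>0 u in auto)
  have "n \<le> m1" unfolding m1_def by (rule card_state_actions_ge)
  then have "int ((m1 - n) * K) = (int m1 - int n) * (1 + \<lfloor>if \<omega> = 0 then 0 else ln (1 - \<omega>) / ln \<omega>\<rfloor>)"
    using K(1) by (simp add: of_nat_diff)
  then show ?thesis using stops_within[OF K(2) \<kappa>(3)] by (simp add: m1_def)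
qed

end
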